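(* There exists a unique formal power series $Q(x,a)\equiv Q(t,x,a)\in\mathbb{Z}[a,x][[t]]$ satisfying $$Q(x,a)=t(x+1)^2(1+a)^2+t(1+x)\frac{Q(x,a)-Q(x,0)}{a}\left((1+a)^2+a\,\frac{Q(x,a)-Q(0,a)}{x}\right)+t(1+x)\,a\,Q(x,a).$$ Moreover, the generating function $W(t)=\sum_{n\geq 1} w_n t^n$ of $3$-stack-sortable permutations is given by $W(t)=Q(t,0,0)$.
   Context: A permutation is an ordering of a finite set of positive integers; $S_n$ is the set of permutations of $\{1,\dots,n\}$. The stack-sorting map $s$ is defined recursively: $s$ sends the empty permutation to itself, and if $\pi$ is nonempty with largest entry $m$, written $\pi=LmR$ (concatenation), then $s(\pi)=s(L)\,s(R)\,m$. A permutation $\pi$ is $k$-stack-sortable if $s^k(\pi)$ (the $k$-fold iterate) is increasing. Let $w_n$ denote the number of $3$-stack-sortable permutations in $S_n$. The quotients $(Q(x,a)-Q(x,0))/a$ and $(Q(x,a)-Q(0,a))/x$ are understood as formal power series (polynomial division is exact). *)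

theory Defs
  imports "HOL-Computational_Algebra.Computational_Algebra" "HOL-Combinatorics.Multiset_Permutations"
begin

text \<open>Permutations are lists of distinct positive integers. For nonempty pi with
maximum m, pi = L m R and s(pi) = s(L) s(R) m.\<close>

lemma takeWhile_neq_shorter:
  "m \<in> set p \<Longrightarrow> length (takeWhile (\<lambda>z. z \<noteq> m) p) < length p"
  by (induction p) auto

function stack_sort :: "nat list \<Rightarrow> nat list" where
  "stack_sort [] = []"
| "stack_sort (y # ys) =
     (let p = y # ys; m = Max (set p)
      in stack_sort (takeWhile (\<lambda>z. z \<noteq> m) p)
         @ stack_sort (tl (dropWhile (\<lambda>z. z \<noteq> m) p)) @ [m])"
  by pat_completeness auto
termination
proof (relation "measure length")
  fix y :: nat and ys p m
  assume "p = y # ys" "m = Max (set p)"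
  then have "m \<in> set p" using Max_in[of "set p"] by simp
  then show "(takeWhile (\<lambda>z. z \<noteq> m) p, y # ys) \<in> measure length"
    using \<open>p = y # ys\<close> by (auto intro: takeWhile_neq_shorter)
next
  fix y :: nat and ys p m
  assume "p = y # ys" "m = Max (set p)"
  then show "(tl (dropWhile (\<lambda>z. z \<noteq> m) p), y # ys) \<in> measure length"
    using length_dropWhile_le[of "\<lambda>z. z \<noteq> m" p] by simp
qed auto

definition k_stack_sortable :: "nat \<Rightarrow> nat list \<Rightarrow> bool" where
  "k_stack_sortable k p \<longleftrightarrow> sorted_wrt (<) ((stack_sort ^^ k) p)"

definition w :: "nat \<Rightarrow> nat" where
  "w n = card {p \<in> permutations_of_set {1..n}. k_stack_sortable 3 p}"

definition W :: "int fps" where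
  "W = Abs_fps (\<lambda>n. if n = 0 then 0 else int (w n))"

text \<open>An element of Z[a,x] is an int poly poly: the outer variable is x,
the coefficients are polynomials in a.\<close>

definition varX :: "int poly poly" where "varX = [:0, 1:]"
definition varA :: "int poly poly" where "varA = [:[:0, 1:]:]"

definition subst_a0 :: "int poly poly fps \<Rightarrow> int poly poly fps" where
  "subst_a0 Q = Abs_fps (\<lambda>n. map_poly (\<lambda>c. [:coeff c 0:]) (Q $ n))"

definition subst_x0 :: "int poly poly fps \<Rightarrow> int poly poly fps" where
  "subst_x0 Q = Abs_fps (\<lambda>n. [:coeff (Q $ n) 0:])"

text \<open>Division by a resp. x (exact on the series where it is applied, as
the constant term in that variable has been subtracted).\<close>
definition div_a :: "int poly poly fps \<Rightarrow> int poly poly fps" where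
  "div_a F = Abs_fps (\<lambda>n. map_poly (poly_shift 1) (F $ n))"

definition div_x :: "int poly poly fps \<Rightarrow> int poly poly fps" where
  "div_x F = Abs_fps (\<lambda>n. poly_shift 1 (F $ n))"

definition eval00 :: "int poly poly fps \<Rightarrow> int fps" where
  "eval00 Q = Abs_fps (\<lambda>n. coeff (coeff (Q $ n) 0) 0)"

definition functional_eq :: "int poly poly fps \<Rightarrow> bool" where
  "functional_eq Q \<longleftrightarrow>
     Q = fps_X * fps_const ((varX + 1)^2 * (1 + varA)^2)
       + fps_X * fps_const (1 + varX) * div_a (Q - subst_a0 Q)
           * (fps_const ((1 + varA)^2) + fps_const varA * div_x (Q - subst_x0 Q))
       + fps_X * fps_const ((1 + varX) * varA) * Q"

end

theory Submission
  imports Defs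
begin

text \<open>
A permutation counted by \<open>w n\<close> is a preimage under \<open>s\<close> of some \<open>\<sigma>\<close> with \<open>s \<sigma>\<close> avoiding 231,
so \<open>w n\<close> is a sum of fertilities (numbers of preimages). Append to each \<open>\<sigma>\<close> a tail of \<open>l\<close> larger
increasing entries, with weight \<open>y ^ l\<close>, and give \<open>\<sigma>\<close> the weight \<open>(1 + x) ^ k\<close>, where \<open>k\<close> is the number
of places at which \<open>s \<sigma>\<close> can be cut into a smaller part followed by a larger part. Writing
\<open>\<sigma> = L m R\<close> with \<open>m\<close> maximal, the fertility of \<open>L m R\<close> with a tail is a convolution of those
of \<open>L\<close> and \<open>R\<close> with tails (Defant's decomposition lemma), while \<open>s \<sigma>\<close> avoids 231 iff \<open>s L\<close> and \<open>s R\<close> do and the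
entries of \<open>R\<close> exceed those of \<open>L\<close>, except that the largest entry of \<open>L\<close> may sit at any cut of \<open>s R\<close>. The resulting
recurrence becomes the functional equation under \<open>y = a / (1 + a)\<^sup>2\<close>, that is, \<open>1 + a = C(y)\<close>
for the Catalan series \<open>C\<close>.
\<close>

section \<open>Stack sorting, pattern avoidance and cuts\<close>

text \<open>Replaces the defining recursion from here on: the maximum is read off from the split
  instead of being computed by \<open>Max\<close>.\<close>

lemma stack_sort_append:
  assumes "\<forall>x \<in> set L \<union> set R. x < m"
  shows "stack_sort (L @ m # R) = stack_sort L @ stack_sort R @ [m]"
proof -
  obtain y ys where y: "L @ m # R = y # ys"
    by (cases "L @ m # R") auto
  have M: "Max (set (y # ys)) = m"
    unfolding y[symmetric] by (rule Max_eqI) (use assms in \<open>auto intro: less_imp_le\<close>)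
  have "takeWhile (\<lambda>z. z \<noteq> m) (L @ m # R) = L" "dropWhile (\<lambda>z. z \<noteq> m) (L @ m # R) = m # R"
    using assms by (auto simp: takeWhile_append dropWhile_append)
  with M show ?thesis
    unfolding y by (simp del: set_simps)
qed

lemma split_at_Max:
  fixes p :: "nat list"
  assumes "p \<noteq> []" "distinct p"
  obtains L R where "p = L @ Max (set p) # R" "\<forall>x \<in> set L \<union> set R. x < Max (set p)"
proof -
  define m where "m = Max (set p)"
  have "m \<in> set p"
    unfolding m_def using assms by (intro Max_in) auto
  then obtain L R where p: "p = L @ m # R"
    by (meson split_list)
  have "x < m" if "x \<in> set L \<union> set R" for x
  proof -
    have "x \<le> m"
      unfolding m_def by (rule Max_ge) (use that p in auto)
    moreover have "x \<noteq> m"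
      using that assms(2) p by auto
    ultimately show ?thesis by simp
  qed
  with p show ?thesis
    using that by (simp add: m_def)
qed

text \<open>Follows the recursion of \<open>stack_sort\<close>, so that the induction step can apply
  \<open>stack_sort_append\<close>.\<close>

lemma max_split_induct [consumes 1, case_names Nil split]:
  fixes p :: "nat list"
  assumes "distinct p" "P []"
    and "\<And>L m R. distinct (L @ m # R) \<Longrightarrow> \<forall>x \<in> set L \<union> set R. x < m \<Longrightarrow> P L \<Longrightarrow> P R \<Longrightarrow> P (L @ m # R)"
  shows "P p"
  using assms(1)
proof (induction "length p" arbitrary: p rule: less_induct)
  case less
  show ?case
  proof (cases "p = []")
    case False
    then obtain L R where p: "p = L @ Max (set p) # R" and m: "\<forall>x \<in> set L \<union> set R. x < Max (set p)"
      using split_at_Max less.prems by blast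
    have "distinct (L @ Max (set p) # R)"
      using less.prems by (simp flip: p)
    moreover have "length L < length p" "length R < length p"
      using arg_cong[OF p, of length] by simp_all
    ultimately have "P (L @ Max (set p) # R)"
      using m by (intro assms(3) less.hyps) auto
    then show ?thesis by (simp flip: p)
  qed (simp add: assms(2))
qed

lemma mset_stack_sort: "distinct p \<Longrightarrow> mset (stack_sort p) = mset p"
  by (induction rule: max_split_induct) (simp_all add: stack_sort_append)

lemma set_stack_sort [simp]: "distinct p \<Longrightarrow> set (stack_sort p) = set p"
  by (metis mset_stack_sort set_mset_mset)

lemma length_stack_sort [simp]: "distinct p \<Longrightarrow> length (stack_sort p) = length p"
  by (metis mset_stack_sort size_mset)

lemma distinct_stack_sort [simp]: "distinct p \<Longrightarrow> distinct (stack_sort p)"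
  by (metis mset_stack_sort mset_eq_imp_distinct_iff)

text \<open>An increasing relabelling keeps the maximum in its place, so it commutes with each step
  of the recursion.\<close>

lemma stack_sort_map:
  assumes "distinct p" "strict_mono_on (set p) f"
  shows "stack_sort (map f p) = map f (stack_sort p)"
  using assms
proof (induction rule: max_split_induct)
  case (split L m R)
  have "\<forall>x \<in> set (map f L) \<union> set (map f R). x < f m"
    using split.hyps(2) strict_mono_onD[OF split.prems] by auto
  moreover have "strict_mono_on (set L) f" "strict_mono_on (set R) f"
    using split.prems by (auto simp: monotone_on_def)
  ultimately show ?case
    using split.IH split.hyps(2) by (simp add: stack_sort_append)
qed simp

lemma stack_sort_ends_with_Max:
  assumes "distinct p" "p \<noteq> []"
  obtains q where "stack_sort p = q @ [Max (set p)]" "\<forall>x \<in> set q. x < Max (set p)"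
proof -
  obtain L R where p: "p = L @ Max (set p) # R" and m: "\<forall>x \<in> set L \<union> set R. x < Max (set p)"
    using split_at_Max assms by blast
  then have "stack_sort p = (stack_sort L @ stack_sort R) @ [Max (set p)]"
    by (metis stack_sort_append append.assoc)
  moreover have "distinct L" "distinct R"
    using assms(1) by (subst (asm) p, simp)+
  ultimately show ?thesis
    using m by (intro that) auto
qed

section \<open>Avoidance of 231 and sorting in one pass\<close>

fun avoids231 :: "nat list \<Rightarrow> bool" where
  "avoids231 [] = True"
| "avoids231 (x # xs) \<longleftrightarrow> avoids231 xs \<and> sorted_wrt (\<lambda>y z. \<not> (z < x \<and> x < y)) xs"

lemma sorted_wrt_trivial: "(\<And>x y. x \<in> set xs \<Longrightarrow> y \<in> set xs \<Longrightarrow> P x y) \<Longrightarrow> sorted_wrt P xs"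
  by (induction xs) auto

text \<open>A 231 pattern that meets both lists has in \<open>xs\<close> either only its 2, or its 2
  and its 3.\<close>

lemma avoids231_append:
  "avoids231 (xs @ ys) \<longleftrightarrow> avoids231 xs \<and> avoids231 ys
     \<and> (\<forall>x \<in> set xs. sorted_wrt (\<lambda>y z. \<not> (z < x \<and> x < y)) ys)
     \<and> (\<forall>z \<in> set ys. sorted_wrt (\<lambda>x y. \<not> (z < x \<and> x < y)) xs)"
  by (induction xs) (auto simp: sorted_wrt_append)

lemma avoids231_append_less:
  assumes "\<forall>x \<in> set xs. \<forall>y \<in> set ys. x < y"
  shows "avoids231 (xs @ ys) \<longleftrightarrow> avoids231 xs \<and> avoids231 ys"
proof -
  have "sorted_wrt (\<lambda>y z. \<not> (z < x \<and> x < y)) ys" if "x \<in> set xs" for x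
    using assms that by (intro sorted_wrt_trivial) (auto dest: less_asym)
  moreover have "sorted_wrt (\<lambda>x y. \<not> (z < x \<and> x < y)) xs" if "z \<in> set ys" for z
    using assms that by (intro sorted_wrt_trivial) (auto dest: less_asym)
  ultimately show ?thesis
    by (auto simp: avoids231_append)
qed

lemma avoids231_snoc: "\<forall>x \<in> set xs. x < m \<Longrightarrow> avoids231 (xs @ [m]) \<longleftrightarrow> avoids231 xs"
  by (simp add: avoids231_append_less)

lemma avoids231_map:
  "strict_mono_on (set xs) f \<Longrightarrow> avoids231 (map f xs) \<longleftrightarrow> avoids231 xs"
proof (induction xs)
  case (Cons x xs)
  have "strict_mono_on (set xs) f"
    using Cons.prems by (auto simp: monotone_on_def)
  moreover have "f y < f z \<longleftrightarrow> y < z" if "y \<in> set (x # xs)" "z \<in> set (x # xs)" for y z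
    using strict_mono_on_less[OF Cons.prems] that by simp
  then have "sorted_wrt (\<lambda>y z. \<not> (f z < f x \<and> f x < f y)) xs
      \<longleftrightarrow> sorted_wrt (\<lambda>y z. \<not> (z < x \<and> x < y)) xs"
    by (intro iffI; elim sorted_wrt_mono_rel[rotated]) simp_all
  ultimately show ?case
    using Cons.IH by (simp add: sorted_wrt_map)
qed simp

text \<open>Knuth's criterion. The image of \<open>L @ m # R\<close> is increasing iff those of
  \<open>L\<close> and \<open>R\<close> are and \<open>L\<close> lies below \<open>R\<close>; an
  entry \<open>x\<close> of \<open>L\<close> above an entry \<open>y\<close> of \<open>R\<close>
  gives the 231 pattern \<open>x\<close>, \<open>m\<close>, \<open>y\<close>.\<close>

lemma sorted_stack_sort_iff:
  "distinct p \<Longrightarrow> sorted_wrt (<) (stack_sort p) \<longleftrightarrow> avoids231 p"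
proof (induction rule: max_split_induct)
  case (split L m R)
  have d: "distinct L" "distinct R" and ne: "x \<noteq> y" if "x \<in> set L" "y \<in> set R" for x y
    using split.hyps(1) that by auto
  have "sorted_wrt (<) (stack_sort (L @ m # R)) \<longleftrightarrow> avoids231 L \<and> avoids231 R
      \<and> (\<forall>x \<in> set L. \<forall>y \<in> set R. x < y)"
    using split by (auto simp: stack_sort_append sorted_wrt_append)
  also have "\<dots> \<longleftrightarrow> avoids231 (L @ m # R)"
  proof (cases "\<forall>x \<in> set L. \<forall>y \<in> set R. x < y")
    case True
    have "sorted_wrt (\<lambda>y z. \<not> (z < m \<and> m < y)) R"
      using split.hyps(2) by (intro sorted_wrt_trivial) (auto dest: less_asym)
    then show ?thesis
      using True split.hyps(2) by (subst avoids231_append_less) auto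
  next
    case False
    then obtain x y where xy: "x \<in> set L" "y \<in> set R" "\<not> x < y"
      by blast
    then have "y < x" "x < m"
      using split.hyps ne[of x y] by auto
    then have "\<not> sorted_wrt (\<lambda>y z. \<not> (z < x \<and> x < y)) (m # R)"
      using xy by auto
    with xy(1) False show ?thesis
      by (auto simp: avoids231_append)
  qed
  finally show ?case .
qed simp

section \<open>Cuts into a smaller and a larger part\<close>

definition cuts :: "nat list \<Rightarrow> nat set" where
  "cuts p = {i. i \<le> length p \<and> (\<forall>x \<in> set (take i p). \<forall>y \<in> set (drop i p). x < y)}"

lemma finite_cuts [simp]: "finite (cuts p)"
  by (rule finite_subset[of _ "{..length p}"]) (auto simp: cuts_def)

lemma length_in_cuts [simp]: "length p \<in> cuts p" and zero_in_cuts [simp]: "0 \<in> cuts p"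
  by (simp_all add: cuts_def)

lemma cuts_le_length: "i \<in> cuts p \<Longrightarrow> i \<le> length p"
  by (simp add: cuts_def)

lemma cuts_map:
  assumes "strict_mono_on (set p) f"
  shows "cuts (map f p) = cuts p"
proof -
  have "f x < f y \<longleftrightarrow> x < y" if "x \<in> set (take i p)" "y \<in> set (drop i p)" for i x y
    using that by (intro strict_mono_on_less[OF assms]) (auto dest: in_set_takeD in_set_dropD)
  then show ?thesis
    by (auto simp: cuts_def take_map drop_map)
qed

lemma cuts_append:
  assumes "\<forall>x \<in> set xs. \<forall>y \<in> set ys. x < y"
  shows "cuts (xs @ ys) = cuts xs \<union> (+) (length xs) ` cuts ys"
proof (intro equalityI subsetI)
  fix i assume i: "i \<in> cuts (xs @ ys)"
  show "i \<in> cuts xs \<union> (+) (length xs) ` cuts ys"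
  proof (cases "i \<le> length xs")
    case False
    then have "i - length xs \<in> cuts ys" "i = length xs + (i - length xs)"
      using i by (auto simp: cuts_def)
    then show ?thesis by blast
  qed (use i in \<open>auto simp: cuts_def\<close>)
next
  fix i assume "i \<in> cuts xs \<union> (+) (length xs) ` cuts ys"
  then show "i \<in> cuts (xs @ ys)"
    using assms by (auto simp: cuts_def dest: in_set_takeD in_set_dropD)
qed

text \<open>The joint is counted twice, as the trivial cut at the end of \<open>xs\<close> and at
  the start of \<open>ys\<close>; hence the \<open>+ 1\<close>.\<close>

lemma card_cuts_append:
  assumes "\<forall>x \<in> set xs. \<forall>y \<in> set ys. x < y"
  shows "card (cuts (xs @ ys)) + 1 = card (cuts xs) + card (cuts ys)"
proof -
  have "cuts xs \<inter> (+) (length xs) ` cuts ys = {length xs}"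
    using length_in_cuts[of xs] zero_in_cuts[of ys] by (force dest: cuts_le_length)
  moreover have "card ((+) (length xs) ` cuts ys) = card (cuts ys)"
    by (simp add: card_image)
  ultimately show ?thesis
    using card_Un_Int[of "cuts xs" "(+) (length xs) ` cuts ys"] by (simp add: cuts_append[OF assms])
qed

lemma card_cuts_singleton: "card (cuts [m]) = 2"
proof -
  have "cuts [m] = {0, 1}"
    using zero_in_cuts[of "[m]"] length_in_cuts[of "[m]"] cuts_le_length[of _ "[m]"]
    by (auto simp del: zero_in_cuts length_in_cuts simp: le_Suc_eq)
  then show ?thesis by simp
qed

lemma card_cuts_snoc:
  "\<forall>x \<in> set xs. x < m \<Longrightarrow> card (cuts (xs @ [m])) = Suc (card (cuts xs))"
  using card_cuts_append[of xs "[m]"] by (simp add: card_cuts_singleton)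

text \<open>Every value below an entry of the first part also lies in the first part, so by counting
  it consists of the \<open>d\<close> smallest values.\<close>

lemma set_take_cut:
  assumes "distinct p" "set p = {1..n}" "d \<in> cuts p"
  shows "set (take d p) = {1..d}" "set (drop d p) = {d<..n}"
proof -
  define A B where "A = set (take d p)" "B = set (drop d p)"
  have len: "length p = n"
    using assms(1,2) by (metis card_atLeastAtMost diff_Suc_1 distinct_card)
  have AB: "A \<union> B = {1..n}" "A \<inter> B = {}"
    unfolding A_B_def using assms(1,2) set_take_disj_set_drop_if_distinct[of p d d]
    by (metis append_take_drop_id set_append, simp)
  have lt: "x < y" if "x \<in> A" "y \<in> B" for x y
    using assms(3) that by (auto simp: cuts_def A_B_def)
  have card: "card A = d" "d \<le> n"
    using assms(1,3) len by (simp_all add: A_B_def distinct_card cuts_le_length min_def cuts_def)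
  have fin: "finite A" by (simp add: A_B_def)
  have "A \<subseteq> {1..d}"
  proof
    fix x assume x: "x \<in> A"
    have "{1..x} \<subseteq> A"
    proof
      fix v assume v: "v \<in> {1..x}"
      moreover have "x \<le> n"
        using x AB by auto
      ultimately have "v \<in> A \<union> B"
        by (simp add: AB)
      moreover have "v \<notin> B"
        using lt[OF x, of v] v by auto
      ultimately show "v \<in> A"
        by blast
    qed
    then have "x \<le> d"
      using card_mono[OF fin, of "{1..x}"] card by simp
    then show "x \<in> {1..d}"
      using x AB by auto
  qed
  then have A: "A = {1..d}"
    using card by (intro card_subset_eq) auto
  moreover have "B = {1..n} - A"
    using AB by blast
  ultimately show "set (take d p) = {1..d}" "set (drop d p) = {d<..n}"
    by (auto simp flip: A_B_def)
qed

text \<open>In a permutation of \<open>{1..n}\<close> a cut can be described by values instead of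
  positions. The right-hand side says that a new first entry with value between \<open>d\<close> and
  \<open>d + 1\<close> is not the 2 of a 231 pattern.\<close>

lemma cut_iff_sorted_wrt:
  assumes "distinct p" "set p = {1..n}" "d \<le> n"
  shows "d \<in> cuts p \<longleftrightarrow> sorted_wrt (\<lambda>y z. \<not> (z \<le> d \<and> d < y)) p"
proof
  assume d: "d \<in> cuts p"
  note s = set_take_cut[OF assms(1,2) d]
  have "sorted_wrt (\<lambda>y z. \<not> (z \<le> d \<and> d < y)) (take d p @ drop d p)"
    unfolding sorted_wrt_append by (intro conjI sorted_wrt_trivial ballI) (auto simp: s)
  then show "sorted_wrt (\<lambda>y z. \<not> (z \<le> d \<and> d < y)) p" by simp
next
  assume sw: "sorted_wrt (\<lambda>y z. \<not> (z \<le> d \<and> d < y)) p"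
  define A B where "A = takeWhile (\<lambda>v. v \<le> d) p" "B = dropWhile (\<lambda>v. v \<le> d) p"
  have p: "p = A @ B" by (simp add: A_B_def)
  have A: "\<forall>v \<in> set A. v \<le> d"
    by (auto simp: A_B_def dest: set_takeWhileD)
  have B: "\<forall>v \<in> set B. d < v"
  proof (cases B)
    case (Cons b B')
    then have "d < b"
      using hd_dropWhile[of "\<lambda>v. v \<le> d" p] by (simp add: A_B_def)
    moreover have "sorted_wrt (\<lambda>y z. \<not> (z \<le> d \<and> d < y)) B"
      using sw by (simp add: p sorted_wrt_append)
    ultimately show ?thesis
      using Cons by auto
  qed simp
  have "set A = {1..d}"
    using A B assms(2,3) p by (fastforce simp: set_eq_iff)
  then have "length A = d"
    using assms(1) p distinct_card[of A] by simp
  then show "d \<in> cuts p"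
    using A B by (force simp: p cuts_def)
qed

section \<open>Fertility\<close>

text \<open>The number of preimages of \<open>p\<close> under \<open>stack_sort\<close>, as
  \<open>card_stack_sort_preimage\<close> shows. The index \<open>i\<close> runs over all ways to
  cut \<open>butlast p\<close> into the images of the two sides of the maximum, empty sides
  included.\<close>

function fert :: "nat list \<Rightarrow> nat" where
  "fert p = (if p = [] then 1
     else if \<forall>x \<in> set (butlast p). x < last p
       then \<Sum>i<length p. fert (take i (butlast p)) * fert (drop i (butlast p))
     else 0)"
  by pat_completeness auto
termination
  by (relation "measure length") (auto simp: min_def)

declare fert.simps [simp del]

lemma fert_Nil [simp]: "fert [] = 1"
  by (simp add: fert.simps)

lemma fert_snoc:
  "fert (p @ [m]) = (if \<forall>x \<in> set p. x < m
     then \<Sum>i\<le>length p. fert (take i p) * fert (drop i p) else 0)"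
  by (subst fert.simps) (simp add: lessThan_Suc_atMost)

lemma fert_eq_0:
  assumes "\<not> (\<forall>x \<in> set (butlast p). x < last p)"
  shows "fert p = 0"
  using assms by (subst fert.simps) auto

text \<open>A preimage has the form \<open>L @ m # R\<close>, where the images of \<open>L\<close>
  and \<open>R\<close> concatenate to \<open>q\<close>. Sorting preserves length, so the length
  \<open>i\<close> of \<open>L\<close> fixes where \<open>q\<close> is cut.\<close>

lemma stack_sort_preimages_snoc:
  assumes "distinct (q @ [m])" "\<forall>x \<in> set q. x < m" "i \<le> length q"
  shows "{p. distinct p \<and> stack_sort p = q @ [m] \<and> length (takeWhile (\<lambda>z. z \<noteq> m) p) = i}
    = (\<lambda>(L, R). L @ m # R) ` ({L. distinct L \<and> stack_sort L = take i q} \<times> {R. distinct R \<and> stack_sort R = drop i q})"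
    (is "?A = ?f ` (?B \<times> ?C)")
proof (intro equalityI subsetI)
  fix p assume p: "p \<in> ?A"
  then have "p \<noteq> []" "distinct p" by auto
  then obtain L R where LR: "p = L @ Max (set p) # R" "\<forall>x \<in> set L \<union> set R. x < Max (set p)"
    using split_at_Max by blast
  have "set p = set (q @ [m])"
    using p by (metis (mono_tags, lifting) mem_Collect_eq set_stack_sort)
  then have "Max (set p) = m"
    using assms(2) by (intro Max_eqI) (auto intro: less_imp_le)
  with LR have LR: "p = L @ m # R" "\<forall>x \<in> set L \<union> set R. x < m"
    by simp_all
  have d: "distinct L" "distinct R"
    using \<open>distinct p\<close> LR(1) by auto
  have q: "stack_sort L @ stack_sort R = q"
    using p LR by (auto simp: stack_sort_append)
  have "takeWhile (\<lambda>z. z \<noteq> m) p = L"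
    using LR by (auto simp: takeWhile_append)
  then have "length (stack_sort L) = i"
    using p d by simp
  then have "stack_sort L = take i q" "stack_sort R = drop i q"
    using q by auto
  then show "p \<in> ?f ` (?B \<times> ?C)"
    using d LR(1) by (auto simp: image_iff)
next
  fix p assume "p \<in> ?f ` (?B \<times> ?C)"
  then obtain L R where LR: "p = L @ m # R" "distinct L" "distinct R"
      "stack_sort L = take i q" "stack_sort R = drop i q"
    by auto
  then have s: "set L = set (take i q)" "set R = set (drop i q)"
    by (metis set_stack_sort)+
  then have lt: "\<forall>x \<in> set L \<union> set R. x < m"
    using assms(2) by (auto dest: in_set_takeD in_set_dropD)
  have "distinct p"
    using assms(1) LR lt s set_take_disj_set_drop_if_distinct[of q i i] by auto
  moreover have "takeWhile (\<lambda>z. z \<noteq> m) p = L"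
    using LR lt by (auto simp: takeWhile_append)
  moreover have "length L = i"
    using LR(2,4) assms(3) length_stack_sort[of L] by simp
  ultimately show "p \<in> ?A"
    using LR lt by (simp add: stack_sort_append)
qed

text \<open>The preimages are sorted by the number of entries before the maximum, which gives the
  sum in \<open>fert\<close>. Finiteness is carried along for the cardinality of the disjoint
  union.\<close>

lemma card_stack_sort_preimage:
  assumes "distinct q"
  shows "finite {p. distinct p \<and> stack_sort p = q} \<and> card {p. distinct p \<and> stack_sort p = q} = fert q"
  using assms
proof (induction "length q" arbitrary: q rule: less_induct)
  case less
  show ?case
  proof (cases q rule: rev_cases)
    case Nil
    have "{p. distinct p \<and> stack_sort p = []} = {[]}"
      by (auto simp flip: length_0_conv)
    with Nil show ?thesis by simp
  next
    case (snoc r m)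
    show ?thesis
    proof (cases "\<forall>x \<in> set r. x < m")
      case False
      \<comment> \<open>A nonempty image ends with its maximum, so here there is no
        preimage.\<close>
      have "{p. distinct p \<and> stack_sort p = r @ [m]} = {}"
      proof (intro equals0I)
        fix p assume p: "p \<in> {p. distinct p \<and> stack_sort p = r @ [m]}"
        then have "distinct p" "p \<noteq> []" by auto
        then obtain r' where "stack_sort p = r' @ [Max (set p)]" "\<forall>x \<in> set r'. x < Max (set p)"
          by (rule stack_sort_ends_with_Max)
        then show False
          using p False by auto
      qed
      moreover have "fert q = 0"
        using False snoc fert_eq_0[of q] by simp
      ultimately show ?thesis
        by (simp only: snoc card.empty finite.emptyI)
    next
      case True
      define A where "A i = {p. distinct p \<and> stack_sort p = r @ [m] \<and> length (takeWhile (\<lambda>z. z \<noteq> m) p) = i}" for i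
      define B where "B q = {p. distinct p \<and> stack_sort p = q}" for q
      have A: "A i = (\<lambda>(L, R). L @ m # R) ` (B (take i r) \<times> B (drop i r))" if "i \<le> length r" for i
        unfolding A_def B_def
        by (rule stack_sort_preimages_snoc) (use less.prems snoc True that in auto)
      have IH: "finite (B p)" "card (B p) = fert p" if "distinct p" "length p < length q" for p
        using less.hyps that by (auto simp: B_def)
      have nm: "m \<notin> set L" if "L \<in> B r'" "set r' \<subseteq> set r" for L r'
      proof -
        have "set L = set r'"
          using that set_stack_sort[of L] by (auto simp: B_def)
        then show ?thesis
          using True that by auto
      qed
      have A': "finite (A i)" "card (A i) = fert (take i r) * fert (drop i r)" if "i \<le> length r" for i
      proof -
        have "inj_on (\<lambda>(L, R). L @ m # R) (B (take i r) \<times> B (drop i r))"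
          by (auto simp: inj_on_def append_Cons_eq_iff nm set_take_subset set_drop_subset)
        moreover have "finite (B (take i r))" "finite (B (drop i r))"
          "card (B (take i r)) = fert (take i r)" "card (B (drop i r)) = fert (drop i r)"
          using less.prems snoc by (simp_all add: IH)
        ultimately show "finite (A i)" "card (A i) = fert (take i r) * fert (drop i r)"
          using that by (simp_all add: A card_image card_cartesian_product)
      qed
      have len: "length (takeWhile (\<lambda>z. z \<noteq> m) p) \<le> length r" if "p \<in> B q" for p
      proof -
        have "length p = length q"
          using that length_stack_sort[of p] by (auto simp: B_def)
        moreover have "m \<in> set p"
          using that snoc set_stack_sort[of p] by (auto simp: B_def)
        ultimately show ?thesis
          using takeWhile_neq_shorter[of m p] snoc by simp
      qed
      have U: "B q = (\<Union>i\<le>length r. A i)"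
        using len snoc by (auto simp: A_def B_def)
      have "card (B q) = (\<Sum>i\<le>length r. card (A i))"
        unfolding U using A' by (intro card_UN_disjoint) (auto simp: A_def)
      also have "\<dots> = fert q"
        using True A' snoc by (simp add: fert_snoc)
      finally have "card (B q) = fert q" .
      moreover have "finite (B q)"
        unfolding U using A' by auto
      ultimately show ?thesis by (simp add: B_def)
    qed
  qed
qed

text \<open>Fertility depends only on relative order. Comparing by positions allows the two lists to
  be changed piecewise, in particular to exchange tails.\<close>

lemma fert_order_iso:
  assumes "length p = length q"
    and "\<And>i j. i < length p \<Longrightarrow> j < length p \<Longrightarrow> p ! i < p ! j \<longleftrightarrow> q ! i < q ! j"
  shows "fert p = fert q"
  using assms
proof (induction "length p" arbitrary: p q rule: less_induct)
  case less
  show ?case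
  proof (cases p rule: rev_cases)
    case Nil
    then show ?thesis using less.prems by simp
  next
    case (snoc p' m)
    then obtain q' m' where q: "q = q' @ [m']" and len: "length p' = length q'"
      using less.prems(1) by (cases q rule: rev_cases) auto
    have iso: "p' ! i < p' ! j \<longleftrightarrow> q' ! i < q' ! j" if "i < length p'" "j < length p'" for i j
      using less.prems(2)[of i j] that snoc q len by (simp add: nth_append)
    have "p' ! i < m \<longleftrightarrow> q' ! i < m'" if "i < length p'" for i
      using less.prems(2)[of i "length p'"] that snoc q len by (simp add: nth_append)
    then have "(\<forall>x \<in> set p'. x < m) \<longleftrightarrow> (\<forall>x \<in> set q'. x < m')"
      using len by (simp add: all_set_conv_all_nth)
    moreover have "fert (take i p') = fert (take i q')" "fert (drop i p') = fert (drop i q')" for i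
      using snoc len iso by (intro less.hyps; auto)+
    ultimately show ?thesis
      by (simp add: snoc q fert_snoc len)
  qed
qed

section \<open>Fertility with an increasing tail\<close>

definition tail_fert :: "nat list \<Rightarrow> nat \<Rightarrow> nat" where
  "tail_fert p l = fert (p @ [Suc (sum_list p)..<Suc (sum_list p) + l])"

text \<open>The tail chosen in \<open>tail_fert\<close> starts at \<open>Suc (sum_list p)\<close>
  only because this exceeds all entries of \<open>p\<close>; any other increasing tail above
  \<open>p\<close> of the same length is order isomorphic.\<close>

lemma fert_append_tail:
  assumes "sorted_wrt (<) ts" "\<forall>x \<in> set p. \<forall>y \<in> set ts. x < y"
  shows "fert (p @ ts) = tail_fert p (length ts)"
  unfolding tail_fert_def
proof (rule fert_order_iso)
  define N where "N = Suc (sum_list p)"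
  have lt: "p ! i < N + k" if "i < length p" for i k
    using member_le_sum_list[of "p ! i" p] that by (simp add: N_def)
  have lt': "p ! i < ts ! j" if "i < length p" "j < length ts" for i j
    using assms(2) that by simp
  have ts: "ts ! i < ts ! j \<longleftrightarrow> i < j" if "i < length ts" "j < length ts" for i j
    using sorted_wrt_nth_less[OF assms(1)] that by (metis less_asym less_linear nat_neq_iff)
  fix i j assume ij: "i < length (p @ ts)" "j < length (p @ ts)"
  have "ts ! (i - length p) < p ! j \<longleftrightarrow> False" if "\<not> i < length p" "j < length p"
    using lt'[of j "i - length p"] that ij by fastforce
  moreover have "ts ! (i - length p) < ts ! (j - length p) \<longleftrightarrow> i < j" if "\<not> i < length p" "\<not> j < length p"
    using ts[of "i - length p" "j - length p"] that ij by (simp add: diff_less_mono2 less_diff_iff)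
  ultimately show "(p @ ts) ! i < (p @ ts) ! j \<longleftrightarrow>
    (p @ [Suc (sum_list p)..<Suc (sum_list p) + length ts]) ! i
      < (p @ [Suc (sum_list p)..<Suc (sum_list p) + length ts]) ! j"
    unfolding N_def[symmetric]
    using ij lt[of i "j - length p"] lt[of j "i - length p"] lt'[of i "j - length p"]
    by (cases "i < length p"; cases "j < length p")
       (simp_all add: nth_append nth_upt less_diff_iff not_less less_imp_le del: upt_Suc)
qed (simp del: upt_Suc)

lemma tail_fert_map:
  assumes "strict_mono_on (set p) f"
  shows "tail_fert (map f p) l = tail_fert p l"
proof -
  \<comment> \<open>A bound for the entries before and after relabelling, so that one tail serves
    both lists.\<close>
  define N where "N = Suc (sum_list p + sum_list (map f p))"
  have "x < N" "f x < N" if "x \<in> set p" for x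
    using member_le_sum_list[of x p] member_le_sum_list[of "f x" "map f p"] that
    by (auto simp: N_def)
  note N = this
  have "fert (map f p @ [N..<N + l]) = fert (p @ [N..<N + l])"
  proof (rule fert_order_iso)
    fix i j assume "i < length (map f p @ [N..<N + l])" "j < length (map f p @ [N..<N + l])"
    then show "(map f p @ [N..<N + l]) ! i < (map f p @ [N..<N + l]) ! j
      \<longleftrightarrow> (p @ [N..<N + l]) ! i < (p @ [N..<N + l]) ! j"
      using N[of "p ! i"] N[of "p ! j"] strict_mono_on_less[OF assms, of "p ! i" "p ! j"]
      by (auto simp: nth_append)
  qed simp
  moreover have "fert (map f p @ [N..<N + l]) = tail_fert (map f p) l"
    using N by (subst fert_append_tail) (force simp: sorted_wrt_upt)+
  moreover have "fert (p @ [N..<N + l]) = tail_fert p l"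
    using N by (subst fert_append_tail) (force simp: sorted_wrt_upt)+
  ultimately show ?thesis by simp
qed

lemma tail_fert_0: "tail_fert p 0 = fert p"
  by (simp add: tail_fert_def)

lemma tail_fert_snoc:
  assumes "\<forall>x \<in> set p. x < m"
  shows "tail_fert (p @ [m]) l = tail_fert p (Suc l)"
proof -
  define ts where "ts = [Suc m..<Suc m + l]"
  have ts: "sorted_wrt (<) ts" "length ts = l" "\<forall>y \<in> set ts. m < y"
    by (auto simp: ts_def simp del: upt_Suc)
  have "fert ((p @ [m]) @ ts) = tail_fert (p @ [m]) (length ts)"
    by (rule fert_append_tail) (use assms ts in force)+
  moreover have "fert (p @ m # ts) = tail_fert p (length (m # ts))"
    by (rule fert_append_tail) (use assms ts in force)+
  ultimately show ?thesis by (simp add: ts(2))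
qed

lemma sum_atMost_add:
  fixes h :: "nat \<Rightarrow> 'a::comm_monoid_add"
  shows "(\<Sum>i\<le>m + n. h i) = (\<Sum>i\<le>m. h i) + (\<Sum>j<n. h (m + Suc j))"
  by (induction n) (simp_all add: add.assoc)

text \<open>The Catalan numbers, here as fertilities of increasing lists; \<open>cat_Suc\<close> is
  their usual recurrence.\<close>

abbreviation cat :: "nat \<Rightarrow> nat" where
  "cat \<equiv> tail_fert []"

text \<open>The last tail entry is the maximum. The first sum has the cuts inside \<open>p\<close>
  or at its end, the second those after \<open>Suc j\<close> of the remaining \<open>l\<close> tail
  entries.\<close>

lemma tail_fert_Suc:
  "tail_fert p (Suc l) = (\<Sum>i\<le>length p. fert (take i p) * tail_fert (drop i p) l)
     + (\<Sum>j<l. tail_fert p (Suc j) * cat (l - Suc j))"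
proof -
  define N where "N = Suc (sum_list p)"
  have N: "x < N" if "x \<in> set p" for x
    using member_le_sum_list[of x p] that by (auto simp: N_def)
  define ts where "ts = [N..<N + l]"
  have ts: "sorted_wrt (<) ts" "length ts = l" "\<forall>x \<in> set p. \<forall>y \<in> set ts. x < y"
    using N by (force simp: ts_def sorted_wrt_upt)+
  have tail: "fert (p' @ take i ts) = tail_fert p' (min l i)"
      "fert (p' @ drop i ts) = tail_fert p' (l - i)" if "set p' \<subseteq> set p" for p' i
  proof -
    have "fert (p' @ take i ts) = tail_fert p' (length (take i ts))"
      "fert (p' @ drop i ts) = tail_fert p' (length (drop i ts))"
      using ts that
      by (intro fert_append_tail; auto simp: sorted_wrt_take sorted_wrt_drop dest: in_set_takeD in_set_dropD)+
    then show "fert (p' @ take i ts) = tail_fert p' (min l i)" "fert (p' @ drop i ts) = tail_fert p' (l - i)"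
      by (simp_all add: ts(2))
  qed
  have "tail_fert p (Suc l) = fert ((p @ ts) @ [N + l])"
    by (simp add: tail_fert_def ts_def N_def)
  also have "\<dots> = (\<Sum>i\<le>length p + l. fert (take i (p @ ts)) * fert (drop i (p @ ts)))"
    using N ts(2) by (subst fert_snoc) (fastforce simp: ts_def)
  also have "\<dots> = (\<Sum>i\<le>length p. fert (take i p) * fert (drop i p @ drop 0 ts))
      + (\<Sum>j<l. fert (p @ take (Suc j) ts) * fert ([] @ drop (Suc j) ts))"
    unfolding sum_atMost_add by (intro arg_cong2[of _ _ _ _ "(+)"] sum.cong) auto
  also have "\<dots> = (\<Sum>i\<le>length p. fert (take i p) * tail_fert (drop i p) l)
      + (\<Sum>j<l. tail_fert p (Suc j) * cat (l - Suc j))"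
    by (intro arg_cong2[of _ _ _ _ "(+)"] sum.cong refl; subst tail)
       (auto simp only: tail set_drop_subset empty_subsetI set_simps min_absorb2 Suc_le_eq lessThan_iff diff_zero)
  finally show ?thesis .
qed

lemma cat_0: "cat 0 = 1"
  by (simp add: tail_fert_0)

lemma cat_Suc: "cat (Suc n) = (\<Sum>i\<le>n. cat i * cat (n - i))"
proof -
  have "(\<Sum>i\<le>0 + n. cat i * cat (n - i)) = cat 0 * cat n + (\<Sum>j<n. cat (Suc j) * cat (n - Suc j))"
    unfolding sum_atMost_add by simp
  then show ?thesis
    using tail_fert_Suc[of "[]" n] by (simp add: cat_0)
qed

text \<open>Defant's decomposition lemma. After expanding by \<open>tail_fert_Suc\<close>, cuts
  inside \<open>L\<close> and inside the tail are treated by induction. Of the cuts beyond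
  \<open>m\<close> but before the end of \<open>R\<close>, or at that end, only the one directly
  after \<open>m\<close> contributes.\<close>

lemma tail_fert_split:
  assumes "\<forall>x \<in> set L \<union> set R. x < m" "R \<noteq> []"
  shows "tail_fert (L @ m # R) l = (\<Sum>p<l. tail_fert L (Suc p) * tail_fert R (l - Suc p))"
  using assms(1)
proof (induction l arbitrary: L rule: less_induct)
  case (less l)
  \<comment> \<open>A first part reaching into \<open>R\<close> ends below \<open>m\<close>, so it
    is not an image of \<open>stack_sort\<close>.\<close>
  have zero: "fert (A @ m # R') = 0" if "R' \<noteq> []" "set R' \<subseteq> set R" for A R'
  proof (rule fert_eq_0)
    have "last R' \<in> set R"
      using that last_in_set by blast
    then have "last R' < m"
      using less.prems by blast
    then show "\<not> (\<forall>x \<in> set (butlast (A @ m # R')). x < last (A @ m # R'))"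
      using that(1) by (auto simp: butlast_append)
  qed
  show ?case
  proof (cases l)
    case 0
    then show ?thesis using assms(2) by (simp add: tail_fert_0 zero)
  next
    case (Suc k)
    \<comment> \<open>As power series, the two nested convolutions below are
      \<open>a * b * c\<close> and \<open>a * c * b\<close>. The series \<open>a\<close> is shifted
      because tails attached to \<open>L\<close> have length at least one: they contain
      \<open>m\<close> or its substitute.\<close>
    define a where "a = Abs_fps (\<lambda>i. tail_fert L (Suc i))"
    define b where "b = Abs_fps (tail_fert R)"
    define c where "c = Abs_fps cat"
    have IH: "tail_fert (L' @ m # R) j = (\<Sum>p<j. tail_fert L' (Suc p) * tail_fert R (j - Suc p))"
      if "j < l" "set L' \<subseteq> set L" for j L'
      using that less.prems by (intro less.IH) auto
    have abc: "(\<Sum>j<k. tail_fert (L @ m # R) (Suc j) * cat (k - Suc j))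
      = (\<Sum>p<k. (\<Sum>j<Suc p. tail_fert L (Suc j) * cat (p - j)) * tail_fert R (k - Suc p))"
    proof (cases k)
      case (Suc k')
      have "(\<Sum>j<k. tail_fert (L @ m # R) (Suc j) * cat (k - Suc j)) = (\<Sum>j\<le>k'. (a * b) $ j * c $ (k' - j))"
        using Suc \<open>l = Suc k\<close>
        by (intro sum.cong) (auto simp: IH fps_mult_nth a_def b_def c_def lessThan_Suc_atMost atLeast0AtMost)
      also have "\<dots> = (a * b * c) $ k'"
        by (simp add: fps_mult_nth[of "a * b"] atLeast0AtMost)
      also have "\<dots> = (a * c * b) $ k'"
        by (simp add: mult_ac)
      also have "\<dots> = (\<Sum>j\<le>k'. (a * c) $ j * b $ (k' - j))"
        by (simp add: fps_mult_nth[of "a * c"] atLeast0AtMost)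
      also have "\<dots> = (\<Sum>p<k. (\<Sum>j<Suc p. tail_fert L (Suc j) * cat (p - j)) * tail_fert R (k - Suc p))"
        using Suc
        by (intro sum.cong) (auto simp: fps_mult_nth a_def b_def c_def lessThan_Suc_atMost atLeast0AtMost)
      finally show ?thesis .
    qed simp
    have "(\<Sum>i\<le>length (L @ m # R). fert (take i (L @ m # R)) * tail_fert (drop i (L @ m # R)) k)
       = (\<Sum>i\<le>length L + Suc (length R). fert (take i (L @ m # R)) * tail_fert (drop i (L @ m # R)) k)"
      by simp
    also have "\<dots> = (\<Sum>i\<le>length L. fert (take i L) * tail_fert (drop i L @ m # R) k)
         + (\<Sum>j<Suc (length R). fert (L @ m # take j R) * tail_fert (drop j R) k)"
      unfolding sum_atMost_add by (intro arg_cong2[of _ _ _ _ "(+)"] sum.cong) auto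
    also have "(\<Sum>j<Suc (length R). fert (L @ m # take j R) * tail_fert (drop j R) k)
        = fert (L @ [m]) * tail_fert R k"
      unfolding sum.lessThan_Suc_shift using assms(2)
      by (simp add: zero set_take_subset)
    also have "fert (L @ [m]) = tail_fert L 1"
      using less.prems by (simp add: tail_fert_snoc flip: tail_fert_0)
    also have "(\<Sum>i\<le>length L. fert (take i L) * tail_fert (drop i L @ m # R) k)
        = (\<Sum>i\<le>length L. \<Sum>p<k. fert (take i L) * tail_fert (drop i L) (Suc p) * tail_fert R (k - Suc p))"
      using Suc by (intro sum.cong refl) (simp add: IH set_drop_subset sum_distrib_left mult.assoc)
    also have "\<dots> = (\<Sum>p<k. (\<Sum>i\<le>length L. fert (take i L) * tail_fert (drop i L) (Suc p)) * tail_fert R (k - Suc p))"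
      by (subst sum.swap) (simp add: sum_distrib_right)
    finally have "tail_fert (L @ m # R) l = tail_fert L 1 * tail_fert R k
        + (\<Sum>p<k. (\<Sum>i\<le>length L. fert (take i L) * tail_fert (drop i L) (Suc p)) * tail_fert R (k - Suc p))
        + (\<Sum>p<k. (\<Sum>j<Suc p. tail_fert L (Suc j) * cat (p - j)) * tail_fert R (k - Suc p))"
      using tail_fert_Suc[of "L @ m # R" k] by (simp only: Suc abc)
    \<comment> \<open>For each \<open>p\<close> the two inner sums are the right-hand side of
      \<open>tail_fert_Suc\<close> for \<open>tail_fert L (Suc (Suc p))\<close>.\<close>
    also have "\<dots> = tail_fert L 1 * tail_fert R k
        + (\<Sum>p<k. tail_fert L (Suc (Suc p)) * tail_fert R (k - Suc p))"
      by (simp only: tail_fert_Suc[of L "Suc _"] add.assoc sum.distrib distrib_right diff_Suc_Suc)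
    finally show ?thesis
      unfolding Suc sum.lessThan_Suc_shift by simp
  qed
qed

section \<open>Decomposition at the maximum\<close>

text \<open>By Knuth's criterion, the 2-stack-sortable permutations; their preimages are exactly the
  3-stack-sortable ones.\<close>

definition sortable2 :: "nat \<Rightarrow> nat list set" where
  "sortable2 n = {p. distinct p \<and> set p = {1..n} \<and> avoids231 (stack_sort p)}"

lemma finite_sortable2 [simp]: "finite (sortable2 n)"
  by (rule finite_subset[OF _ finite_permutations_of_set[of "{1..n}"]])
     (auto simp: sortable2_def permutations_of_set_def)

lemma length_sortable2: "p \<in> sortable2 n \<Longrightarrow> length p = n"
  by (metis (mono_tags, lifting) card_atLeastAtMost diff_Suc_1 distinct_card sortable2_def mem_Collect_eq)

lemma w_eq_sum_fert: "w n = (\<Sum>q \<in> sortable2 n. fert q)"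
proof -
  have "k_stack_sortable 3 p \<longleftrightarrow> avoids231 (stack_sort (stack_sort p))" if "distinct p" for p
    using that by (simp add: k_stack_sortable_def eval_nat_numeral sorted_stack_sort_iff)
  then have "{p \<in> permutations_of_set {1..n}. k_stack_sortable 3 p}
    = (\<Union>q \<in> sortable2 n. {p. distinct p \<and> stack_sort p = q})"
    by (auto simp: sortable2_def permutations_of_set_def)
  then have "w n = card (\<Union>q \<in> sortable2 n. {p. distinct p \<and> stack_sort p = q})"
    by (simp add: w_def)
  also have "\<dots> = (\<Sum>q \<in> sortable2 n. card {p. distinct p \<and> stack_sort p = q})"
    using card_stack_sort_preimage by (intro card_UN_disjoint finite_sortable2) (auto simp: sortable2_def)
  also have "\<dots> = (\<Sum>q \<in> sortable2 n. fert q)"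
    using card_stack_sort_preimage by (intro sum.cong) (auto simp: sortable2_def)
  finally show ?thesis .
qed

text \<open>Sorting moves the maximum to the end, where it completes no 231 pattern. The same holds
  when it is the first entry.\<close>

lemma snoc_in_sortable2_iff: "p @ [Suc n] \<in> sortable2 (Suc n) \<longleftrightarrow> p \<in> sortable2 n"
proof -
  have "insert (Suc n) (set p) = {1..Suc n} \<and> Suc n \<notin> set p \<longleftrightarrow> set p = {1..n}"
    using insert_ident[of "Suc n" "set p" "{1..n}"] by (auto simp: atLeastAtMostSuc_conv)
  moreover have "avoids231 (stack_sort (p @ [Suc n])) \<longleftrightarrow> avoids231 (stack_sort p)"
    if "distinct p" "set p = {1..n}"
    using that by (simp add: stack_sort_append avoids231_snoc)
  ultimately show ?thesis
    unfolding sortable2_def mem_Collect_eq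
    by (metis distinct1_rotate rotate1.simps(2) set_rotate1 distinct.simps(2) list.simps(15))
qed

lemma Cons_in_sortable2_iff: "Suc n # p \<in> sortable2 (Suc n) \<longleftrightarrow> p \<in> sortable2 n"
proof -
  have "insert (Suc n) (set p) = {1..Suc n} \<and> Suc n \<notin> set p \<longleftrightarrow> set p = {1..n}"
    using insert_ident[of "Suc n" "set p" "{1..n}"] by (auto simp: atLeastAtMostSuc_conv)
  moreover have "avoids231 (stack_sort (Suc n # p)) \<longleftrightarrow> avoids231 (stack_sort p)"
    if "distinct p" "set p = {1..n}"
    using that stack_sort_append[of "[]" p "Suc n"] by (simp add: avoids231_snoc)
  ultimately show ?thesis
    unfolding sortable2_def mem_Collect_eq by (metis distinct.simps(2) list.simps(15))
qed

text \<open>In \<open>L m R\<close> with \<open>s (L m R)\<close> avoiding 231, the entries of \<open>R\<close> exceed all entries of \<open>L\<close>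
except possibly the largest one, which splits \<open>s R\<close> at one of its cuts. The maps \<open>shiftL i d\<close>
and \<open>shiftR i d\<close> relabel \<open>L\<close> (of length \<open>i\<close>) and \<open>R\<close> when exactly \<open>d\<close> entries of \<open>R\<close> lie
below that largest entry.\<close>

definition shiftL :: "nat \<Rightarrow> nat \<Rightarrow> nat \<Rightarrow> nat" where
  "shiftL i d v = (if v < i then v else v + d)"

definition shiftR :: "nat \<Rightarrow> nat \<Rightarrow> nat \<Rightarrow> nat" where
  "shiftR i d v = (if v \<le> d then i - 1 + v else i + v)"

lemma strict_mono_on_shiftL: "strict_mono_on A (shiftL i d)"
  and strict_mono_on_shiftR: "strict_mono_on A (shiftR i d)"
  by (auto simp: monotone_on_def shiftL_def shiftR_def)

lemmas inj_on_shiftL = strict_mono_on_imp_inj_on[OF strict_mono_on_shiftL]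
  and inj_on_shiftR = strict_mono_on_imp_inj_on[OF strict_mono_on_shiftR]

definition glue :: "nat \<Rightarrow> nat \<Rightarrow> nat \<Rightarrow> nat list \<Rightarrow> nat list \<Rightarrow> nat list" where
  "glue n i d L R = map (shiftL i d) L @ Suc n # map (shiftR i d) R"

text \<open>The value \<open>i + d\<close> is that of the largest entry of the relabelled left part,
  and \<open>shiftR i d\<close> skips it: comparing with \<open>i + d\<close> after relabelling is
  comparing with \<open>d\<close> before.\<close>

lemma sorted_wrt_iff_cut:
  assumes "distinct p" "set p = {1..j}" "d \<le> j" "1 \<le> i"
  shows "sorted_wrt (\<lambda>y z. \<not> (z < i + d \<and> i + d < y)) (map (shiftR i d) p) \<longleftrightarrow> d \<in> cuts p"
proof -
  have *: "shiftR i d v < i + d \<longleftrightarrow> v \<le> d" "i + d < shiftR i d v \<longleftrightarrow> d < v" for v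
    using assms(4) by (auto simp: shiftR_def)
  show ?thesis
    by (simp add: sorted_wrt_map * cut_iff_sorted_wrt[OF assms(1-3)])
qed

context
  fixes i j d :: nat and L R :: "nat list"
  assumes L: "distinct L" "set L = {1..i}" and R: "distinct R" "set R = {1..j}"
    and i: "1 \<le> i" and d: "d \<le> j"
begin

lemma glue_less: "\<forall>x \<in> set (map (shiftL i d) L) \<union> set (map (shiftR i d) R). x < Suc (i + j)"
  using L R i d by (auto simp: shiftL_def shiftR_def)

lemma distinct_glue: "distinct (glue (i + j) i d L R)"
  and set_glue: "set (glue (i + j) i d L R) = {1..Suc (i + j)}"
proof -
  have "shiftL i d x \<noteq> shiftR i d y" if "x \<in> set L" "y \<in> set R" for x y
    using that L R i d by (auto simp: shiftL_def shiftR_def)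
  then show d': "distinct (glue (i + j) i d L R)"
    using glue_less L R inj_on_shiftL[where A = "set L"] inj_on_shiftR[where A = "set R"]
    by (auto simp: glue_def distinct_map)
  have "length L = i" "length R = j"
    using L R distinct_card by fastforce+
  then have "card (set (glue (i + j) i d L R)) = Suc (i + j)"
    using distinct_card[OF d'] by (simp add: glue_def)
  moreover have "set (glue (i + j) i d L R) \<subseteq> {1..Suc (i + j)}"
  proof -
    have "1 \<le> shiftL i d x" if "x \<in> set L" for x
      using that L i by (auto simp: shiftL_def)
    moreover have "1 \<le> shiftR i d y" if "y \<in> set R" for y
      using that R i by (auto simp: shiftR_def)
    ultimately show ?thesis
      using glue_less by (fastforce simp: glue_def less_Suc_eq_le intro: le_SucI)
  qed
  ultimately show "set (glue (i + j) i d L R) = {1..Suc (i + j)}"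
    by (intro card_subset_eq) auto
qed

text \<open>\<open>shiftL i d\<close> moves only the value \<open>i\<close>, which stands last in
  the image of \<open>L\<close>, so \<open>q\<close> survives unchanged.\<close>

lemma stack_sort_glue:
  obtains q where "stack_sort L = q @ [i]" "\<forall>x \<in> set q. x < i"
    "stack_sort (glue (i + j) i d L R)
      = (q @ (i + d) # map (shiftR i d) (stack_sort R)) @ [Suc (i + j)]"
proof -
  have "L \<noteq> []" using L i by auto
  moreover have "Max (set L) = i"
    using L i by (intro Max_eqI) auto
  ultimately obtain q where q: "stack_sort L = q @ [i]" "\<forall>x \<in> set q. x < i"
    using stack_sort_ends_with_Max[OF L(1)] by auto
  have "map (shiftL i d) q = q"
    using q(2) by (intro map_idI) (simp add: shiftL_def)
  then have "stack_sort (map (shiftL i d) L) = q @ [i + d]"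
    using L strict_mono_on_shiftL by (simp add: stack_sort_map q shiftL_def)
  moreover have "stack_sort (map (shiftR i d) R) = map (shiftR i d) (stack_sort R)"
    using R strict_mono_on_shiftR by (simp add: stack_sort_map)
  ultimately show ?thesis
    using that q stack_sort_append[OF glue_less] by (simp add: glue_def)
qed

text \<open>\<open>q\<close> lies below all that follows and the final maximum is harmless. What
  remains is \<open>i + d\<close> in front of the relabelled image of \<open>R\<close>, and
  \<open>i + d\<close> is not the 2 of a pattern iff \<open>d\<close> is a cut.\<close>

lemma avoids231_glue_iff:
  "avoids231 (stack_sort (glue (i + j) i d L R))
     \<longleftrightarrow> avoids231 (stack_sort L) \<and> avoids231 (stack_sort R) \<and> d \<in> cuts (stack_sort R)"
proof -
  obtain q where q: "stack_sort L = q @ [i]" "\<forall>x \<in> set q. x < i"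
    and g: "stack_sort (glue (i + j) i d L R)
      = (q @ (i + d) # map (shiftR i d) (stack_sort R)) @ [Suc (i + j)]"
    by (rule stack_sort_glue)
  have lt: "\<forall>x \<in> set q. \<forall>y \<in> set ((i + d) # map (shiftR i d) (stack_sort R)). x < y"
    using q R by (fastforce simp: shiftR_def)
  have "avoids231 (stack_sort (glue (i + j) i d L R))
      \<longleftrightarrow> avoids231 (q @ (i + d) # map (shiftR i d) (stack_sort R))"
    unfolding g using q R d by (intro avoids231_snoc) (auto simp: shiftR_def)
  also have "\<dots> \<longleftrightarrow> avoids231 q \<and> avoids231 ((i + d) # map (shiftR i d) (stack_sort R))"
    by (rule avoids231_append_less[OF lt])
  also have "avoids231 ((i + d) # map (shiftR i d) (stack_sort R))
      \<longleftrightarrow> avoids231 (stack_sort R) \<and> d \<in> cuts (stack_sort R)"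
    using sorted_wrt_iff_cut[of "stack_sort R" j d i] R i d
    by (simp add: avoids231_map[OF strict_mono_on_shiftR])
  finally show ?thesis
    by (simp add: q avoids231_snoc)
qed

text \<open>A cut behind \<open>i + d\<close> needs all later entries to exceed it, so it is a cut
  \<open>e\<close> of the image of \<open>R\<close> with \<open>d \<le> e\<close>. The cut in front
  of \<open>i + d\<close>, the shared joint with \<open>q\<close> and the two final maxima balance
  out.\<close>

lemma card_cuts_glue:
  assumes cut: "d \<in> cuts (stack_sort R)"
  shows "card (cuts (stack_sort (glue (i + j) i d L R)))
    = card (cuts (stack_sort L)) + card {e \<in> cuts (stack_sort R). d \<le> e}"
proof -
  obtain q where q: "stack_sort L = q @ [i]" "\<forall>x \<in> set q. x < i"
    and g: "stack_sort (glue (i + j) i d L R)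
      = (q @ (i + d) # map (shiftR i d) (stack_sort R)) @ [Suc (i + j)]"
    by (rule stack_sort_glue)
  define r where "r = stack_sort R"
  define X where "X = (i + d) # map (shiftR i d) r"
  have r: "distinct r" "set r = {1..j}"
    using R by (simp_all add: r_def)
  have lt: "\<forall>x \<in> set q. \<forall>y \<in> set X. x < y"
    using q R by (fastforce simp: shiftR_def r_def X_def)
  have len: "length r = j"
    using r distinct_card by fastforce
  have "i + d < shiftR i d v \<longleftrightarrow> d < v" for v
    using i by (auto simp: shiftR_def)
  \<comment> \<open>As \<open>d\<close> is a cut, the entries before position \<open>d\<close> are
    at most \<open>d\<close> and those after it exceed \<open>d\<close>.\<close>
  moreover have "(\<forall>v \<in> set (drop e r). d < v) \<longleftrightarrow> d \<le> e" if "e \<le> j" for e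
  proof
    assume "d \<le> e"
    then have "set (drop e r) \<subseteq> set (drop d r)"
      by (rule set_drop_subset_set_drop)
    then show "\<forall>v \<in> set (drop e r). d < v"
      using set_take_cut[OF r] cut by (auto simp: r_def)
  next
    assume *: "\<forall>v \<in> set (drop e r). d < v"
    show "d \<le> e"
    proof (rule ccontr)
      assume "\<not> d \<le> e"
      then have "e < d" by simp
      then have "r ! e \<in> set (take d r)"
        using len d by (auto simp: in_set_conv_nth intro!: exI[of _ e])
      then have "r ! e \<le> d"
        using set_take_cut[OF r] cut by (auto simp: r_def)
      moreover have "r ! e \<in> set (drop e r)"
        using \<open>e < d\<close> d len by (metis Cons_nth_drop_Suc list.set_intros(1) order_less_le_trans)
      ultimately show False using * by force
    qed
  qed
  ultimately have "Suc e \<in> cuts X \<longleftrightarrow> e \<in> cuts r \<and> d \<le> e" for e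
    using cuts_map[OF strict_mono_on_shiftR[of "set r" i d], THEN eqset_imp_iff, of e] len
    unfolding X_def cuts_def by (auto simp: drop_map take_map)
  then have "cuts X = insert 0 (Suc ` {e \<in> cuts r. d \<le> e})"
    by (auto simp: set_eq_iff image_iff) (metis not0_implies_Suc)
  then have "card (cuts X) = Suc (card {e \<in> cuts r. d \<le> e})"
    by (simp add: card_image)
  moreover have "card (cuts (q @ X)) + 1 = card (cuts q) + card (cuts X)"
    by (rule card_cuts_append[OF lt])
  moreover have "card (cuts ((q @ X) @ [Suc (i + j)])) = Suc (card (cuts (q @ X)))"
    using q R d by (intro card_cuts_snoc) (auto simp: shiftR_def X_def r_def)
  moreover have "card (cuts (q @ [i])) = Suc (card (cuts q))"
    using q by (intro card_cuts_snoc)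
  ultimately show ?thesis
    by (simp add: g q X_def r_def)
qed

lemma tail_fert_glue:
  assumes "1 \<le> j"
  shows "tail_fert (glue (i + j) i d L R) l = (\<Sum>p<l. tail_fert L (Suc p) * tail_fert R (l - Suc p))"
proof -
  have "R \<noteq> []" using R assms by auto
  then show ?thesis
    unfolding glue_def by (subst tail_fert_split[OF glue_less])
      (simp_all add: tail_fert_map[OF strict_mono_on_shiftL] tail_fert_map[OF strict_mono_on_shiftR])
qed

end

lemma glue_in_sortable2_iff:
  assumes "distinct L" "set L = {1..i}" "distinct R" "set R = {1..n - i}" "1 \<le> i" "i < n" "d \<le> n - i"
  shows "glue n i d L R \<in> sortable2 (Suc n) \<longleftrightarrow> L \<in> sortable2 i \<and> R \<in> sortable2 (n - i) \<and> d \<in> cuts (stack_sort R)"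
proof -
  have n: "i + (n - i) = n"
    using assms(6) by simp
  note facts = distinct_glue[OF assms(1-5,7)] set_glue[OF assms(1-5,7)] avoids231_glue_iff[OF assms(1-5,7)]
  show ?thesis
    using facts[unfolded n] assms(1-4) unfolding sortable2_def mem_Collect_eq by simp
qed

lemma obtain_preimage_list:
  assumes "distinct p" "set p = f ` A" "inj_on f A"
  obtains q where "distinct q" "set q = A" "p = map f q"
proof
  let ?q = "map (inv_into A f) p"
  show "distinct ?q"
    using assms by (simp add: distinct_map inj_on_inv_into)
  show "set ?q = A"
    using assms by (simp add: inv_into_image_cancel)
  have "map f ?q = map id p"
    unfolding map_map by (rule map_cong[OF refl]) (simp add: assms(2) f_inv_into_f)
  then show "p = map f ?q" by simp
qed

text \<open>Let the image of \<open>A\<close> be \<open>q @ [M]\<close>. An entry of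
  \<open>q\<close> above an entry of \<open>B\<close> would form a 231 pattern with \<open>M\<close>
  as its 3. Hence \<open>q\<close> takes the values below \<open>i\<close>, and \<open>M\<close> is
  the only entry of \<open>A\<close> that may exceed entries of \<open>B\<close>.\<close>

lemma sortable2_glueE:
  assumes p: "p \<in> sortable2 (Suc n)" "p = A @ Suc n # B" and ne: "A \<noteq> []" "B \<noteq> []"
  obtains i L R d where "1 \<le> i" "i < n" "L \<in> sortable2 i" "R \<in> sortable2 (n - i)" "d \<in> cuts (stack_sort R)"
    "p = glue n i d L R"
proof -
  define i where "i = length A"
  define j where "j = length B"
  have dist: "distinct A" "distinct B" "set A \<inter> set B = {}" "Suc n \<notin> set A \<union> set B"
    and set: "insert (Suc n) (set A \<union> set B) = {1..Suc n}"
    using p by (auto simp: sortable2_def)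
  have AB: "set A \<union> set B = {1..n}"
    using set dist(4) insert_ident[of "Suc n" "set A \<union> set B" "{1..n}"]
    by (simp add: atLeastAtMostSuc_conv)
  have n: "n = i + j"
    using length_sortable2[OF p(1)] p(2) by (simp add: i_def j_def)
  have ij: "1 \<le> i" "1 \<le> j"
    using ne by (simp_all add: i_def j_def Suc_le_eq)
  define M where "M = Max (set A)"
  obtain q where q: "stack_sort A = q @ [M]" "\<forall>x \<in> set q. x < M"
    using stack_sort_ends_with_Max[OF dist(1) ne(1)] by (auto simp: M_def)
  have setA: "set A = insert M (set q)"
    using set_stack_sort[OF dist(1)] q(1) by simp
  have "avoids231 ((q @ [M]) @ stack_sort B @ [Suc n])"
    using p AB stack_sort_append[of A B "Suc n"] by (auto simp: sortable2_def q)
  then have "sorted_wrt (\<lambda>x y. \<not> (z < x \<and> x < y)) (q @ [M])" if "z \<in> set B" for z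
    using that dist unfolding avoids231_append[of "q @ [M]"] by simp
  then have qB: "x < z" if "x \<in> set q" "z \<in> set B" for x z
    using that q(2) dist(3) setA by (fastforce simp: sorted_wrt_append)
  \<comment> \<open>The permutation \<open>q @ M # B\<close> of \<open>{1..n}\<close> has a cut
    after \<open>q\<close>, which determines the values of \<open>q\<close>.\<close>
  have "length q = i - 1"
    using length_stack_sort[OF dist(1)] q(1) by (simp add: i_def)
  moreover have "distinct (q @ M # B)" "set (q @ M # B) = {1..n}"
    using distinct_stack_sort[OF dist(1)] q dist setA AB by auto
  moreover have "length q \<in> cuts (q @ M # B)"
    using q(2) qB by (auto simp: cuts_def)
  ultimately have setq: "set q = {1..i - 1}" and setB: "insert M (set B) = {i - 1<..n}"
    using set_take_cut[of "q @ M # B" n "i - 1"] by simp_all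
  have M: "i \<le> M" "M \<le> n" "M \<notin> set B"
    using setB dist(3) setA ij by (auto simp: set_eq_iff)
  \<comment> \<open>The number of entries of \<open>B\<close> below \<open>M\<close>, since
    \<open>M\<close> and \<open>B\<close> together fill the values from \<open>i\<close> to
    \<open>n\<close>.\<close>
  define d where "d = M - i"
  have d: "d \<le> j" "M = i + d"
    using M n by (auto simp: d_def)
  have "set A = shiftL i d ` {1..i}"
  proof -
    have "{1..i} = insert i {1..i - 1}"
      using ij by auto
    moreover have "shiftL i d ` {1..i - 1} = {1..i - 1}"
      by (force simp: shiftL_def)
    ultimately show ?thesis
      by (simp add: setA setq d(2) shiftL_def)
  qed
  then obtain L where L: "distinct L" "set L = {1..i}" "A = map (shiftL i d) L"
    using obtain_preimage_list[OF dist(1) _ inj_on_shiftL] by metis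
  have "set B = shiftR i d ` {1..j}"
  proof (intro equalityI subsetI)
    fix v assume v: "v \<in> set B"
    then have v': "i \<le> v" "v \<le> n" "v \<noteq> M"
    proof -
      have "v \<in> {i - 1<..n}"
        using v setB by blast
      then show "i \<le> v" "v \<le> n" by auto
    qed (use v M(3) in blast)
    show "v \<in> shiftR i d ` {1..j}"
    proof (cases "v < M")
      case True
      then have "v = shiftR i d (v - (i - 1))" "v - (i - 1) \<in> {1..j}"
        using v' d ij n by (auto simp: shiftR_def)
      then show ?thesis by blast
    next
      case False
      then have "v = shiftR i d (v - i)" "v - i \<in> {1..j}"
        using v' d ij n by (auto simp: shiftR_def)
      then show ?thesis by blast
    qed
  next
    fix v assume "v \<in> shiftR i d ` {1..j}"
    then have "v \<in> {i - 1<..n}" "v \<noteq> M"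
      using d ij n by (auto simp: shiftR_def split: if_splits)
    then show "v \<in> set B"
      using setB by blast
  qed
  then obtain R where R: "distinct R" "set R = {1..j}" "B = map (shiftR i d) R"
    using obtain_preimage_list[OF dist(2) _ inj_on_shiftR] by metis
  have g: "p = glue n i d L R"
    using p L R by (simp add: glue_def)
  then have "L \<in> sortable2 i \<and> R \<in> sortable2 (n - i) \<and> d \<in> cuts (stack_sort R)"
    using p(1) L R ij d n by (subst glue_in_sortable2_iff[symmetric]) auto
  with g ij n show ?thesis
    using that[of i L R d] by simp
qed

section \<open>The decomposition as a bijection\<close>

definition glue_data :: "nat \<Rightarrow> (nat \<times> nat list \<times> nat list \<times> nat) set" where
  "glue_data n = (SIGMA i:{1..<n}. SIGMA L:sortable2 i. SIGMA R:sortable2 (n - i). cuts (stack_sort R))"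

text \<open>The position of \<open>Suc n\<close> reveals both halves and \<open>i\<close>. Then
  \<open>d\<close> is recovered because \<open>i + d\<close> is the only value of the left half that
  is at least \<open>i\<close>.\<close>

lemma inj_on_glue: "inj_on (\<lambda>(i, L, R, d). glue n i d L R) (glue_data n)"
proof (rule inj_onI)
  fix x x' assume x: "x \<in> glue_data n" "x' \<in> glue_data n"
    and eq: "(\<lambda>(i, L, R, d). glue n i d L R) x = (\<lambda>(i, L, R, d). glue n i d L R) x'"
  obtain i L R d i' L' R' d' where [simp]: "x = (i, L, R, d)" "x' = (i', L', R', d')"
    by (metis prod.exhaust)
  have 1: "1 \<le> i" "i < n" "L \<in> sortable2 i" "R \<in> sortable2 (n - i)" "d \<in> cuts (stack_sort R)"
    and 2: "1 \<le> i'" "i' < n" "L' \<in> sortable2 i'" "R' \<in> sortable2 (n - i')" "d' \<in> cuts (stack_sort R')"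
    using x by (auto simp: glue_data_def)
  have bound: "\<forall>x \<in> set (map (shiftL i d) L) \<union> set (map (shiftR i d) R). x < Suc n"
    if "1 \<le> i" "i < n" "L \<in> sortable2 i" "R \<in> sortable2 (n - i)" "d \<in> cuts (stack_sort R)" for i d L R
  proof -
    have "d \<le> n - i"
      using cuts_le_length[OF that(5)] that(4) length_sortable2[OF that(4)] by (simp add: sortable2_def)
    then show ?thesis
      using glue_less[of L i R "n - i" d] that by (simp add: sortable2_def)
  qed
  have maps: "map (shiftL i d) L = map (shiftL i' d') L'" "map (shiftR i d) R = map (shiftR i' d') R'"
    using eq bound[OF 1] bound[OF 2]
      append_Cons_eq_iff[of "Suc n" "map (shiftL i d) L" "map (shiftR i d) R"
        "map (shiftL i' d') L'" "map (shiftR i' d') R'"]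
    by (auto simp: glue_def)
  have "length L = length L'"
    using arg_cong[OF maps(1), of length] by simp
  then have ii: "i' = i"
    using length_sortable2 1 2 by metis
  have "i \<in> set L" "set L' = {1..i}"
    using 1 2 ii by (auto simp: sortable2_def)
  then have "shiftL i d i \<in> set (map (shiftL i d) L)"
    by simp
  then have "shiftL i d i \<in> set (map (shiftL i d') L')"
    by (simp only: maps(1) ii)
  then obtain v where "v \<in> {1..i}" "shiftL i d i = shiftL i d' v"
    using \<open>set L' = {1..i}\<close> by auto
  then have dd: "d' = d"
    by (auto simp: shiftL_def split: if_splits)
  have "L = L'" "R = R'"
    using maps by (simp_all add: ii dd inj_map_eq_map[OF inj_on_shiftL] inj_map_eq_map[OF inj_on_shiftR])
  with ii dd show "x = x'" by simp
qed

lemma sortable2_Suc_eq: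
  assumes "1 \<le> n"
  shows "sortable2 (Suc n) = (\<lambda>L. L @ [Suc n]) ` sortable2 n \<union> (\<lambda>R. Suc n # R) ` sortable2 n
     \<union> (\<lambda>(i, L, R, d). glue n i d L R) ` glue_data n"
proof (intro equalityI subsetI)
  fix p assume p: "p \<in> sortable2 (Suc n)"
  then have "Suc n \<in> set p" by (simp add: sortable2_def)
  then obtain A B where AB: "p = A @ Suc n # B"
    by (meson split_list)
  consider "B = []" | "A = []" | "A \<noteq> []" "B \<noteq> []" by blast
  then show "p \<in> (\<lambda>L. L @ [Suc n]) ` sortable2 n \<union> (\<lambda>R. Suc n # R) ` sortable2 n
     \<union> (\<lambda>(i, L, R, d). glue n i d L R) ` glue_data n"
  proof cases
    case 3
    with p AB obtain i L R d where "1 \<le> i" "i < n" "L \<in> sortable2 i" "R \<in> sortable2 (n - i)"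
        "d \<in> cuts (stack_sort R)" "p = glue n i d L R"
      by (rule sortable2_glueE)
    then have "p = (\<lambda>(i, L, R, d). glue n i d L R) (i, L, R, d)" "(i, L, R, d) \<in> glue_data n"
      by (auto simp: glue_data_def)
    then show ?thesis by blast
  qed (use p AB in \<open>auto simp: snoc_in_sortable2_iff Cons_in_sortable2_iff\<close>)
next
  fix p assume "p \<in> (\<lambda>L. L @ [Suc n]) ` sortable2 n \<union> (\<lambda>R. Suc n # R) ` sortable2 n
     \<union> (\<lambda>(i, L, R, d). glue n i d L R) ` glue_data n"
  then consider L where "p = L @ [Suc n]" "L \<in> sortable2 n" | R where "p = Suc n # R" "R \<in> sortable2 n"
    | i L R d where "p = glue n i d L R" "1 \<le> i" "i < n" "L \<in> sortable2 i" "R \<in> sortable2 (n - i)"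
        "d \<in> cuts (stack_sort R)"
    by (fastforce simp: glue_data_def)
  then show "p \<in> sortable2 (Suc n)"
  proof cases
    case 3
    have "d \<le> n - i"
      using cuts_le_length[OF 3(6)] 3(5) length_sortable2[OF 3(5)] by (simp add: sortable2_def)
    with 3 show ?thesis
      by (subst 3(1), subst glue_in_sortable2_iff) (auto simp: sortable2_def)
  qed (simp_all add: snoc_in_sortable2_iff Cons_in_sortable2_iff)
qed

lemma finite_glue_data [simp]: "finite (glue_data n)"
  by (auto simp: glue_data_def intro!: finite_SigmaI)

text \<open>The maximum is last, first, or has entries on both sides; for \<open>n \<ge> 1\<close>
  these cases exclude each other.\<close>

lemma sum_sortable2_Suc:
  fixes F :: "nat list \<Rightarrow> 'a::comm_monoid_add"
  assumes "1 \<le> n"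
  shows "sum F (sortable2 (Suc n)) = (\<Sum>L \<in> sortable2 n. F (L @ [Suc n])) + (\<Sum>R \<in> sortable2 n. F (Suc n # R))
    + (\<Sum>i = 1..<n. \<Sum>L \<in> sortable2 i. \<Sum>R \<in> sortable2 (n - i). \<Sum>d \<in> cuts (stack_sort R). F (glue n i d L R))"
proof -
  let ?A = "(\<lambda>L. L @ [Suc n]) ` sortable2 n" and ?B = "(\<lambda>R. Suc n # R) ` sortable2 n"
    and ?C = "(\<lambda>(i, L, R, d). glue n i d L R) ` glue_data n"
  have n0: "[] \<notin> sortable2 n" if "0 < n" for n
    using that by (auto simp: sortable2_def)
  have max: "Suc n \<notin> set p" if "p \<in> sortable2 n" for p
    using that by (auto simp: sortable2_def)
  have "?A \<inter> ?B = {}"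
  proof -
    have False if "L \<in> sortable2 n" "R \<in> sortable2 n" "L @ [Suc n] = Suc n # R" for L R
      using that n0[of n] max[of L] assms by (auto simp: append_eq_Cons_conv)
    then show ?thesis by blast
  qed
  moreover have "(?A \<union> ?B) \<inter> ?C = {}"
  proof -
    have False if "(i, L, R, d) \<in> glue_data n" "p \<in> sortable2 n"
      "glue n i d L R = p @ [Suc n] \<or> glue n i d L R = Suc n # p" for i L R d p
    proof -
      have *: "1 \<le> i" "i < n" "L \<in> sortable2 i" "R \<in> sortable2 (n - i)"
        using that by (auto simp: glue_data_def)
      then have "R \<noteq> []" "L \<noteq> []"
        using n0 by (metis zero_less_diff, metis less_le_trans zero_less_one)
      moreover have "x \<in> set p" if "A @ x # B = p @ [x] \<or> A @ x # B = x # p" "A \<noteq> []" "B \<noteq> []"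
        for x and A B :: "nat list"
        using that by (cases B rule: rev_cases; cases A) auto
      ultimately have "Suc n \<in> set p"
        using that(3) by (metis glue_def list.map_disc_iff)
      then show False
        using max that(2) by blast
    qed
    then show ?thesis by fastforce
  qed
  ultimately have "sum F (sortable2 (Suc n)) = sum F ?A + sum F ?B + sum F ?C"
    unfolding sortable2_Suc_eq[OF assms] by (simp add: sum.union_disjoint)
  moreover have "sum F ?A = (\<Sum>L \<in> sortable2 n. F (L @ [Suc n]))" "sum F ?B = (\<Sum>R \<in> sortable2 n. F (Suc n # R))"
    by (simp_all add: sum.reindex inj_on_def)
  moreover have "sum F ?C
      = (\<Sum>i = 1..<n. \<Sum>L \<in> sortable2 i. \<Sum>R \<in> sortable2 (n - i). \<Sum>d \<in> cuts (stack_sort R). F (glue n i d L R))"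
    unfolding sum.reindex[OF inj_on_glue] unfolding glue_data_def
    by (simp add: sum.Sigma comp_def case_prod_beta)
  ultimately show ?thesis by simp
qed

section \<open>The recurrence\<close>

text \<open>The polynomial \<open>1 + x\<close>. From here on an \<open>int poly\<close> outside of
  Z[a,x] has the variable \<open>x\<close>.\<close>

definition u :: "int poly" where
  "u = [:1, 1:]"

text \<open>As \<open>d\<close> runs through \<open>S\<close>, the exponent takes each value from 1
  to \<open>card S\<close> once, so this is a geometric sum.\<close>

lemma sum_power_card_ge:
  fixes x :: "'a::comm_ring_1" and S :: "nat set"
  assumes "finite S"
  shows "(x - 1) * (\<Sum>d \<in> S. x ^ card {e \<in> S. d \<le> e}) = x * (x ^ card S - 1)"
  using assms
proof (induction S rule: finite_linorder_min_induct)
  case (insert b S)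
  have "{e \<in> insert b S. b \<le> e} = insert b S"
    using insert by auto
  moreover have "{e \<in> insert b S. d \<le> e} = {e \<in> S. d \<le> e}" if "d \<in> S" for d
    using insert that by auto
  moreover have "b \<notin> S"
    using insert by auto
  ultimately show ?case
    using insert by (simp add: algebra_simps)
qed simp

lemma X_times_poly_shift: "[:0, 1:] * poly_shift 1 p = p - [:coeff p 0:]"
  for p :: "'a::comm_ring_1 poly"
  by (rule poly_eqI) (auto simp: coeff_pCons coeff_poly_shift split: nat.split)

lemma u_minus_1: "u - 1 = [:0, 1:]"
  by (simp add: u_def one_pCons)

text \<open>The coefficient of \<open>t ^ n * y ^ l\<close> in the weighted generating function. The
  value 0 at \<open>n = 0\<close> leaves out the empty permutation, as the series \<open>Q\<close>
  has no constant term in \<open>t\<close>.\<close>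

definition sortable_poly :: "nat \<Rightarrow> nat \<Rightarrow> int poly" where
  "sortable_poly n l = (if n = 0 then 0
     else \<Sum>p \<in> sortable2 n. of_nat (tail_fert p l) * u ^ card (cuts (stack_sort p)))"

lemma coeff_u_power_0: "coeff (of_nat k * u ^ m) 0 = int k"
  by (simp add: u_def coeff_mult_0 coeff_0_power of_nat_poly)

lemma sortable2_1: "sortable2 (Suc 0) = {[1]}"
proof -
  have "p = [1]" if "distinct p" "set p = {1}" for p :: "nat list"
  proof -
    have "length p = Suc 0"
      using that distinct_card[of p] by simp
    then obtain x where "p = [x]"
      by (auto simp only: length_Suc_conv length_0_conv)
    then show ?thesis
      using that(2) by simp
  qed
  then show ?thesis
    by (auto simp: sortable2_def)
qed

lemma sortable_poly_1: "sortable_poly (Suc 0) l = u ^ 2 * of_nat (cat (Suc l))"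
proof -
  have "tail_fert [1] l = cat (Suc l)"
    using tail_fert_snoc[of "[]" 1 l] by simp
  moreover have "stack_sort [1] = [1]"
    using stack_sort_append[of "[]" "[]" 1] by simp
  ultimately show ?thesis
    by (simp add: sortable_poly_def sortable2_1 card_cuts_singleton mult.commute)
qed

lemma X_times_shift_sortable_poly:
  assumes "1 \<le> n"
  shows "(u - 1) * poly_shift 1 (sortable_poly n l)
    = (\<Sum>p \<in> sortable2 n. of_nat (tail_fert p l) * (u ^ card (cuts (stack_sort p)) - 1))"
proof -
  have "coeff (sortable_poly n l) 0 = of_nat (\<Sum>p \<in> sortable2 n. tail_fert p l)"
    using assms by (simp add: sortable_poly_def coeff_sum coeff_u_power_0)
  then have "[:coeff (sortable_poly n l) 0:] = of_nat (\<Sum>p \<in> sortable2 n. tail_fert p l)"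
    by (simp only: of_nat_poly)
  then have "[:coeff (sortable_poly n l) 0:] = (\<Sum>p \<in> sortable2 n. of_nat (tail_fert p l))"
    by (simp only: of_nat_sum)
  then show ?thesis
    unfolding u_minus_1 X_times_poly_shift right_diff_distrib sum_subtractf mult_1_right
    using assms by (simp add: sortable_poly_def)
qed

text \<open>Multiplied by \<open>x = u - 1\<close>, both sides agree by the geometric sum. Thus
  summing over the admissible cuts \<open>d\<close> amounts to the divided difference in
  \<open>x\<close>.\<close>

lemma u_times_shift_sortable_poly:
  assumes "1 \<le> n"
  shows "u * poly_shift 1 (sortable_poly n l)
    = (\<Sum>p \<in> sortable2 n. of_nat (tail_fert p l)
        * (\<Sum>d \<in> cuts (stack_sort p). u ^ card {e \<in> cuts (stack_sort p). d \<le> e}))"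
proof -
  have "(u - 1) * (\<Sum>p \<in> sortable2 n. of_nat (tail_fert p l)
        * (\<Sum>d \<in> cuts (stack_sort p). u ^ card {e \<in> cuts (stack_sort p). d \<le> e}))
     = (\<Sum>p \<in> sortable2 n. of_nat (tail_fert p l)
        * ((u - 1) * (\<Sum>d \<in> cuts (stack_sort p). u ^ card {e \<in> cuts (stack_sort p). d \<le> e})))"
    unfolding sum_distrib_left[of "u - 1" _ "sortable2 n"] by (simp only: mult.left_commute)
  also have "\<dots> = u * (\<Sum>p \<in> sortable2 n. of_nat (tail_fert p l) * (u ^ card (cuts (stack_sort p)) - 1))"
    by (simp only: sum_power_card_ge[OF finite_cuts] sum_distrib_left[of u _ "sortable2 n"] mult.left_commute)
  also have "\<dots> = (u - 1) * (u * poly_shift 1 (sortable_poly n l))"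
    unfolding X_times_shift_sortable_poly[OF assms, symmetric] by (simp only: mult.left_commute)
  finally show ?thesis
    unfolding mult_cancel_left by (simp add: u_minus_1)
qed

text \<open>The fertility is a convolution and the cut exponents add, so the weight of a glued list
  factors into a part for \<open>L\<close> and a part for \<open>R\<close> and
  \<open>d\<close>.\<close>

lemma sum_glue_weights:
  assumes "1 \<le> i" "i < n"
  shows "(\<Sum>L \<in> sortable2 i. \<Sum>R \<in> sortable2 (n - i). \<Sum>d \<in> cuts (stack_sort R).
      of_nat (tail_fert (glue n i d L R) l) * u ^ card (cuts (stack_sort (glue n i d L R))))
    = (\<Sum>p<l. sortable_poly i (Suc p) * (u * poly_shift 1 (sortable_poly (n - i) (l - Suc p))))"
    (is "?lhs = _")
proof -
  define a where "a L = u ^ card (cuts (stack_sort L))" for L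
  define b where "b R d = u ^ card {e \<in> cuts (stack_sort R). d \<le> e}" for R d
  have n: "i + (n - i) = n" "1 \<le> n - i" using assms by simp_all
  have glue: "of_nat (tail_fert (glue n i d L R) l) * u ^ card (cuts (stack_sort (glue n i d L R)))
      = (\<Sum>p<l. (of_nat (tail_fert L (Suc p)) * a L) * (of_nat (tail_fert R (l - Suc p)) * b R d))"
    if "L \<in> sortable2 i" "R \<in> sortable2 (n - i)" "d \<in> cuts (stack_sort R)" for L R d
  proof -
    have LR: "distinct L" "set L = {1..i}" "distinct R" "set R = {1..n - i}"
      using that by (simp_all add: sortable2_def)
    have d: "d \<le> n - i"
      using cuts_le_length[OF that(3)] LR length_sortable2[OF that(2)] by simp
    show ?thesis
      using tail_fert_glue[OF LR assms(1) d n(2)] card_cuts_glue[OF LR assms(1) d that(3)]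
      unfolding n(1) a_def b_def
      by (simp add: power_add sum_distrib_left sum_distrib_right mult_ac)
  qed
  have "?lhs = (\<Sum>L \<in> sortable2 i. \<Sum>R \<in> sortable2 (n - i). \<Sum>d \<in> cuts (stack_sort R). \<Sum>p<l.
      (of_nat (tail_fert L (Suc p)) * a L) * (of_nat (tail_fert R (l - Suc p)) * b R d))"
    by (intro sum.cong refl glue)
  also have "\<dots> = (\<Sum>p<l. (\<Sum>L \<in> sortable2 i. of_nat (tail_fert L (Suc p)) * a L) *
      (\<Sum>R \<in> sortable2 (n - i). of_nat (tail_fert R (l - Suc p)) * (\<Sum>d \<in> cuts (stack_sort R). b R d)))"
    unfolding sum_product unfolding sum_distrib_left by (simp only: sum.swap[of _ "{..<l}"])
  also have "\<dots> = (\<Sum>p<l. sortable_poly i (Suc p) * (u * poly_shift 1 (sortable_poly (n - i) (l - Suc p))))"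
    unfolding u_times_shift_sortable_poly[OF n(2)] using assms by (simp add: sortable_poly_def a_def b_def)
  finally show ?thesis .
qed

text \<open>The summands stand for the one-element permutation and for the maximum being last,
  inside or first. A last maximum lengthens the tail; a first one is the decomposition lemma with
  \<open>L\<close> empty, whence the Catalan factor.\<close>

lemma sortable_poly_Suc:
  "sortable_poly (Suc n) l = (if n = 0 then u ^ 2 * of_nat (cat (Suc l)) else 0)
     + u * sortable_poly n (Suc l)
     + u * (\<Sum>i\<le>n. \<Sum>p<l. sortable_poly i (Suc p) * poly_shift 1 (sortable_poly (n - i) (l - Suc p)))
     + u * (\<Sum>p<l. of_nat (cat (Suc p)) * sortable_poly n (l - Suc p))"
proof (cases "n = 0")
  case True
  then show ?thesis
    using sortable_poly_1[of l] by (simp add: sortable_poly_def[of 0])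
next
  case False
  then have n: "1 \<le> n" by simp
  define F where "F p = of_nat (tail_fert p l) * u ^ card (cuts (stack_sort p))" for p
  have snoc: "F (L @ [Suc n]) = u * (of_nat (tail_fert L (Suc l)) * u ^ card (cuts (stack_sort L)))"
    if "L \<in> sortable2 n" for L
  proof -
    have L: "distinct L" "\<forall>x \<in> set L. x < Suc n"
      using that by (auto simp: sortable2_def)
    then show ?thesis
      by (simp add: F_def stack_sort_append tail_fert_snoc card_cuts_snoc)
  qed
  have Cons: "F (Suc n # R) = u * (\<Sum>p<l. of_nat (cat (Suc p)) *
      (of_nat (tail_fert R (l - Suc p)) * u ^ card (cuts (stack_sort R))))"
    if "R \<in> sortable2 n" for R
  proof -
    have R: "distinct R" "\<forall>x \<in> set R. x < Suc n" "R \<noteq> []"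
      using that n by (auto simp: sortable2_def)
    then show ?thesis
      using tail_fert_split[of "[]" R "Suc n" l] stack_sort_append[of "[]" R "Suc n"]
      by (simp add: F_def card_cuts_snoc sum_distrib_left sum_distrib_right mult_ac)
  qed
  have "sortable_poly (Suc n) l = sum F (sortable2 (Suc n))"
    by (simp add: sortable_poly_def F_def)
  also have "\<dots> = (\<Sum>L \<in> sortable2 n. F (L @ [Suc n])) + (\<Sum>R \<in> sortable2 n. F (Suc n # R))
    + (\<Sum>i = 1..<n. \<Sum>L \<in> sortable2 i. \<Sum>R \<in> sortable2 (n - i). \<Sum>d \<in> cuts (stack_sort R). F (glue n i d L R))"
    by (rule sum_sortable2_Suc[OF n])
  also have "(\<Sum>L \<in> sortable2 n. F (L @ [Suc n])) = u * sortable_poly n (Suc l)"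
    using False by (simp add: snoc sortable_poly_def sum_distrib_left)
  also have "(\<Sum>R \<in> sortable2 n. F (Suc n # R)) = u * (\<Sum>p<l. of_nat (cat (Suc p)) * sortable_poly n (l - Suc p))"
    using False by (simp add: Cons sortable_poly_def sum_distrib_left sum.swap[of _ "{..<l}"])
  also have "(\<Sum>i = 1..<n. \<Sum>L \<in> sortable2 i. \<Sum>R \<in> sortable2 (n - i). \<Sum>d \<in> cuts (stack_sort R). F (glue n i d L R))
      = (\<Sum>i = 1..<n. \<Sum>p<l. sortable_poly i (Suc p) * (u * poly_shift 1 (sortable_poly (n - i) (l - Suc p))))"
    unfolding F_def by (intro sum.cong refl sum_glue_weights) auto
  \<comment> \<open>The added terms vanish since \<open>sortable_poly 0\<close> is 0; the full range
    matches a product of power series in \<open>t\<close>.\<close>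
  also have "\<dots> = (\<Sum>i\<le>n. \<Sum>p<l. sortable_poly i (Suc p) * (u * poly_shift 1 (sortable_poly (n - i) (l - Suc p))))"
  proof (rule sum.mono_neutral_left)
    show "\<forall>i \<in> {..n} - {1..<n}.
        (\<Sum>p<l. sortable_poly i (Suc p) * (u * poly_shift 1 (sortable_poly (n - i) (l - Suc p)))) = 0"
    proof
      fix i assume "i \<in> {..n} - {1..<n}"
      then have "i = 0 \<or> n - i = 0" by auto
      moreover have "sortable_poly 0 k = 0" for k
        by (simp add: sortable_poly_def)
      moreover have "poly_shift 1 (0 :: int poly) = 0"
        by simp
      ultimately show "(\<Sum>p<l. sortable_poly i (Suc p)
          * (u * poly_shift 1 (sortable_poly (n - i) (l - Suc p)))) = 0"
        by (elim disjE) simp_all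
    qed
  qed auto
  finally show ?thesis
    using False by (simp add: sum_distrib_left mult_ac)
qed

text \<open>Taking \<open>l = 0\<close> removes the tail, and the constant term in \<open>x\<close>
  turns each power of \<open>u\<close> into 1.\<close>

lemma w_eq_coeff_sortable_poly:
  assumes "1 \<le> n"
  shows "int (w n) = coeff (sortable_poly n 0) 0"
  using assms by (simp add: w_eq_sum_fert sortable_poly_def coeff_sum coeff_u_power_0 tail_fert_0)

section \<open>The functional equation\<close>

definition quot_a :: "int poly poly \<Rightarrow> int poly poly" where
  "quot_a p = map_poly (poly_shift 1) p"

text \<open>The right-hand side of the functional equation is \<open>t\<close> times a series; this
  is the coefficient of \<open>t ^ n\<close> in that series when \<open>Q\<close> has coefficients
  \<open>q\<close>.\<close>

definition fe_step :: "(nat \<Rightarrow> int poly poly) \<Rightarrow> nat \<Rightarrow> int poly poly" where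
  "fe_step q n = (if n = 0 then (varX + 1)^2 * (1 + varA)^2 else 0)
     + (1 + varX) * ((1 + varA)^2 * quot_a (q n)
          + varA * (\<Sum>i\<le>n. quot_a (q i) * poly_shift 1 (q (n - i))))
     + (1 + varX) * varA * q n"

lemma nth_div_a: "div_a (Q - subst_a0 Q) $ n = quot_a (Q $ n)"
  unfolding div_a_def subst_a0_def quot_a_def
  by (rule poly_eqI) (auto simp: coeff_map_poly coeff_poly_shift coeff_pCons intro!: poly_eqI split: nat.split)

lemma nth_div_x: "div_x (Q - subst_x0 Q) $ n = poly_shift 1 (Q $ n)"
  unfolding div_x_def subst_x0_def
  by (rule poly_eqI) (auto simp: coeff_poly_shift coeff_pCons split: nat.split)

lemma eq_fps_X_mult_iff:
  fixes F :: "'a::comm_ring_1 fps"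
  shows "F = fps_X * G \<longleftrightarrow> F $ 0 = 0 \<and> (\<forall>n. F $ Suc n = G $ n)"
proof -
  have "F = fps_X * G \<longleftrightarrow> (\<forall>n. F $ n = (fps_X * G) $ n)"
    by (rule fps_eq_iff)
  also have "\<dots> \<longleftrightarrow> F $ 0 = (fps_X * G) $ 0 \<and> (\<forall>n. F $ Suc n = (fps_X * G) $ Suc n)"
    by (metis not0_implies_Suc)
  finally show ?thesis by simp
qed

lemma functional_eq_iff:
  "functional_eq Q \<longleftrightarrow> Q $ 0 = 0 \<and> (\<forall>n. Q $ Suc n = fe_step (fps_nth Q) n)"
proof -
  let ?DA = "div_a (Q - subst_a0 Q)" and ?DX = "div_x (Q - subst_x0 Q)"
  define G where "G = fps_const ((varX + 1)^2 * (1 + varA)^2)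
     + fps_const (1 + varX) * (fps_const ((1 + varA)^2) * ?DA + fps_const varA * (?DA * ?DX))
     + fps_const ((1 + varX) * varA) * Q"
  have "functional_eq Q \<longleftrightarrow> Q = fps_X * G"
    unfolding functional_eq_def G_def by (simp only: algebra_simps)
  moreover have "G $ n = fe_step (fps_nth Q) n" for n
    by (simp only: G_def fe_step_def fps_add_nth fps_mult_left_const_nth fps_nth_fps_const
        fps_mult_nth[of ?DA] nth_div_a nth_div_x atLeast0AtMost)
  ultimately show ?thesis
    unfolding eq_fps_X_mult_iff by simp
qed

text \<open>The formula of \<open>fe_step\<close> is written out so that the recursive calls are
  visibly at indices up to \<open>n\<close>.\<close>

fun fe_sol :: "nat \<Rightarrow> int poly poly" where
  "fe_sol 0 = 0"
| "fe_sol (Suc n) = (if n = 0 then (varX + 1)^2 * (1 + varA)^2 else 0)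
     + (1 + varX) * ((1 + varA)^2 * quot_a (fe_sol n)
          + varA * (\<Sum>i\<le>n. quot_a (fe_sol i) * poly_shift 1 (fe_sol (n - i))))
     + (1 + varX) * varA * fe_sol n"

declare fe_sol.simps(2) [simp del]

text \<open>Each coefficient in \<open>t\<close> is determined by earlier ones, which gives
  existence and uniqueness at once.\<close>

lemma functional_eq_iff_fe_sol: "functional_eq Q \<longleftrightarrow> Q = Abs_fps fe_sol"
proof
  assume Q: "functional_eq Q"
  have "Q $ n = fe_sol n" for n
  proof (induction n rule: less_induct)
    case (less n)
    show ?case
    proof (cases n)
      case (Suc m)
      then have "fe_step (fps_nth Q) m = fe_step fe_sol m"
        unfolding fe_step_def using less
        by (intro arg_cong2[of _ _ _ _ "(+)"] arg_cong2[of _ _ _ _ "(*)"] sum.cong arg_cong[of _ _ quot_a]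
            arg_cong[of _ _ "poly_shift 1"] refl) auto
      then show ?thesis
        using Q unfolding functional_eq_iff Suc by (simp add: fe_step_def fe_sol.simps(2))
    qed (use Q in \<open>simp add: functional_eq_iff\<close>)
  qed
  then show "Q = Abs_fps fe_sol"
    by (simp add: fps_eq_iff)
next
  assume "Q = Abs_fps fe_sol"
  then show "functional_eq Q"
    by (simp add: functional_eq_iff fe_step_def fe_sol.simps(2))
qed

section \<open>Evaluation homomorphisms and the Catalan substitution\<close>

locale poly_eval =
  fixes f :: "'a::comm_ring_1 \<Rightarrow> 'b::comm_ring_1" and b :: 'b
  assumes f_0 [simp]: "f 0 = 0" and f_1 [simp]: "f 1 = 1"
    and f_add: "f (x + y) = f x + f y" and f_mult: "f (x * y) = f x * f y"
begin

text \<open>Used in two nested instances, for \<open>a\<close> over the integers and for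
  \<open>x\<close> over the polynomials in \<open>a\<close>.\<close>

definition ev :: "'a poly \<Rightarrow> 'b" where
  "ev p = poly (map_poly f p) b"

lemma ev_pCons: "ev (pCons c p) = f c + b * ev p"
  by (simp add: ev_def map_poly_pCons)

lemma ev_0 [simp]: "ev 0 = 0"
  by (simp add: ev_def)

lemma ev_1 [simp]: "ev 1 = 1"
  by (simp add: one_pCons ev_pCons)

lemma ev_add: "ev (p + q) = ev p + ev q"
  by (induction p q rule: poly_induct2) (simp_all add: ev_pCons f_add algebra_simps)

lemma ev_smult: "ev (smult c p) = f c * ev p"
  by (induction p) (simp_all add: ev_pCons f_mult algebra_simps)

lemma ev_mult: "ev (p * q) = ev p * ev q"
  by (induction p) (simp_all add: ev_pCons ev_add ev_smult algebra_simps)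

lemma ev_power: "ev (p ^ n) = ev p ^ n"
  by (induction n) (simp_all add: ev_mult)

lemma ev_sum: "ev (\<Sum>i\<in>A. g i) = (\<Sum>i\<in>A. ev (g i))"
  by (induction A rule: infinite_finite_induct) (simp_all add: ev_add)

end

definition cat_fps :: "int poly fps" where
  "cat_fps = Abs_fps (\<lambda>n. of_nat (cat n))"

text \<open>So \<open>fps_X * cat_fps ^ 2\<close> is \<open>C - 1\<close>, the series to be
  substituted for \<open>a\<close>.\<close>

lemma cat_fps_eq: "cat_fps = 1 + fps_X * cat_fps ^ 2"
proof (rule fps_ext)
  fix n
  show "cat_fps $ n = (1 + fps_X * cat_fps ^ 2) $ n"
  proof (cases n)
    case (Suc m)
    have "(cat_fps ^ 2) $ m = (\<Sum>i\<le>m. of_nat (cat i * cat (m - i)))"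
      by (simp add: power2_eq_square fps_mult_nth cat_fps_def atLeast0AtMost)
    then show ?thesis
      using cat_Suc[of m] by (simp add: Suc cat_fps_def)
  qed (simp add: cat_fps_def cat_0)
qed

text \<open>The substitution \<open>a = C(y) - 1\<close>, where \<open>C\<close> is the generating function of the Catalan numbers:
since \<open>a / (1 + a)\<^sup>2 = y\<close>, it turns \<open>(1 + a)\<^sup>2\<close> times the divided difference in \<open>a\<close> into a shift of \<open>y\<close>-coefficients.\<close>

interpretation subst_a: poly_eval "\<lambda>k. fps_const [:k:]" "fps_X * cat_fps ^ 2"
  by unfold_locales (simp_all add: one_pCons mult.commute flip: fps_const_add fps_const_mult)

interpretation subst: poly_eval subst_a.ev "fps_const [:0, 1:]"
  by unfold_locales (simp_all add: subst_a.ev_add subst_a.ev_mult)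

lemma nth_0_subst_a: "subst_a.ev c $ 0 = [:coeff c 0:]"
  by (cases c) (simp add: subst_a.ev_pCons)

text \<open>The image of \<open>a * ((c - c(0)) / a) = c - c(0)\<close>: setting
  \<open>y = 0\<close> after the substitution sets \<open>a = 0\<close>.\<close>

lemma subst_a_quot:
  "fps_X * cat_fps ^ 2 * subst_a.ev (poly_shift 1 c) = subst_a.ev c - fps_const (subst_a.ev c $ 0)"
proof (cases c)
  case (pCons k c')
  have "poly_shift 1 c = c'"
    by (rule poly_eqI) (simp add: pCons coeff_poly_shift)
  then show ?thesis
    by (simp add: nth_0_subst_a) (simp add: pCons subst_a.ev_pCons)
qed

lemma subst_quot_a:
  "fps_X * cat_fps ^ 2 * subst.ev (quot_a p) = subst.ev p - fps_const (subst.ev p $ 0)"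
proof (induction p)
  case (pCons c p)
  have q: "quot_a (pCons c p) = pCons (poly_shift 1 c) (quot_a p)"
    unfolding quot_a_def by (simp add: map_poly_pCons)
  have "fps_X * cat_fps ^ 2 * subst.ev (quot_a (pCons c p))
      = fps_X * cat_fps ^ 2 * subst_a.ev (poly_shift 1 c)
        + fps_const [:0, 1:] * (fps_X * cat_fps ^ 2 * subst.ev (quot_a p))"
    unfolding q subst.ev_pCons by (simp only: algebra_simps)
  also have "\<dots> = subst_a.ev c - fps_const (subst_a.ev c $ 0)
        + fps_const [:0, 1:] * (subst.ev p - fps_const (subst.ev p $ 0))"
    unfolding pCons.IH subst_a_quot ..
  also have "\<dots> = subst.ev (pCons c p) - fps_const (subst.ev (pCons c p) $ 0)"
    unfolding subst.ev_pCons fps_add_nth fps_mult_left_const_nth fps_const_add[symmetric] fps_const_mult[symmetric]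
    by (simp only: algebra_simps)
  finally show ?case .
qed (simp add: quot_a_def)

text \<open>The substitution for \<open>a\<close> does not involve \<open>x\<close>. This is what
  makes it compatible with division by \<open>x\<close>.\<close>

lemma degree_nth_subst_a: "degree (subst_a.ev c $ n) = 0"
proof -
  have mult: "\<forall>n. degree ((F * G) $ n) = 0"
    if "\<forall>n. degree (F $ n) = 0" "\<forall>n. degree (G $ n) = 0" for F G :: "int poly fps"
  proof
    fix n
    have "degree (F $ i * G $ (n - i)) \<le> 0" for i
      using degree_mult_le[of "F $ i" "G $ (n - i)"] that by simp
    then have "degree (\<Sum>i = 0..n. F $ i * G $ (n - i)) \<le> 0"
      by (intro degree_sum_le) auto
    then show "degree ((F * G) $ n) = 0"
      by (simp add: fps_mult_nth)
  qed
  have "\<forall>n. degree (cat_fps $ n) = 0" "\<forall>n. degree ((fps_X :: int poly fps) $ n) = 0"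
    by (simp_all add: cat_fps_def fps_X_def)
  then have c: "\<forall>n. degree ((fps_X * cat_fps ^ 2) $ n) = 0"
    unfolding power2_eq_square by (intro mult)
  have "\<forall>n. degree (subst_a.ev c $ n) = 0"
  proof (induction c)
    case (pCons k c)
    have "degree ((fps_X * cat_fps ^ 2 * subst_a.ev c) $ n) = 0" for n
      using mult[OF c pCons.IH] by blast
    then have "degree ((if n = 0 then [:k:] else 0) + (fps_X * cat_fps ^ 2 * subst_a.ev c) $ n) \<le> 0" for n
      by (intro degree_add_le) (simp_all only: le_zero_eq degree_0 degree_pCons_0 if_distrib if_cancel)
    then show ?case
      unfolding subst_a.ev_pCons fps_add_nth fps_nth_fps_const by blast
  qed simp
  then show ?thesis ..
qed

lemma nth_subst_poly_shift: "subst.ev (poly_shift 1 p) $ n = poly_shift 1 (subst.ev p $ n)"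
proof (cases p)
  case (pCons c p')
  have "poly_shift 1 p = p'"
    by (rule poly_eqI) (simp add: pCons coeff_poly_shift)
  moreover obtain k where "subst_a.ev c $ n = [:k:]"
    using degree_nth_subst_a[of c n] by (metis degree_eq_zeroE)
  ultimately show ?thesis
    by (intro poly_eqI) (simp add: pCons subst.ev_pCons coeff_poly_shift)
qed

lemma fps_mult_nth_Suc:
  fixes F G :: "'a::comm_ring_1 fps"
  assumes "F $ 0 = 0"
  shows "(F * G) $ n = (\<Sum>p<n. F $ Suc p * G $ (n - Suc p))"
proof (cases n)
  case (Suc m)
  have "(F * G) $ n = (\<Sum>i\<le>Suc m. F $ i * G $ (n - i))"
    by (simp add: fps_mult_nth Suc atLeast0AtMost del: sum.atMost_Suc)
  also have "\<dots> = (\<Sum>p\<le>m. F $ Suc p * G $ (n - Suc p))"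
    unfolding sum.atMost_Suc_shift using assms by simp
  finally show ?thesis
    by (simp add: Suc lessThan_Suc_atMost)
qed (simp add: fps_mult_nth assms)

text \<open>The substitution turns the recursion of \<open>fe_sol\<close> into that of
  \<open>sortable_poly\<close>: \<open>1 + a\<close> becomes \<open>C\<close>, the divided
  difference times \<open>(1 + a)^2\<close> a shift in \<open>y\<close>, and products become
  convolutions.\<close>

lemma subst_fe_sol: "subst.ev (fe_sol n) $ l = sortable_poly n l"
proof (induction n arbitrary: l rule: less_induct)
  case (less n)
  show ?case
  proof (cases n)
    case (Suc m)
    define g where "g i = subst.ev (fe_sol i)" for i
    have g: "g i $ l = sortable_poly i l" if "i \<le> m" for i l
      using less Suc that by (simp add: g_def)
    have X: "subst.ev (1 + varX) = fps_const u" "subst.ev (varX + 1) = fps_const u"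
      by (simp_all add: varX_def u_def one_pCons subst.ev_pCons subst_a.ev_pCons)
    have A: "subst.ev varA = fps_X * cat_fps ^ 2"
    proof -
      have varA: "varA = pCons (pCons 0 1) 0"
        by (simp add: varA_def one_pCons)
      show ?thesis
        unfolding varA subst.ev_pCons subst_a.ev_pCons by simp
    qed
    have A1: "subst.ev (1 + varA) = cat_fps"
      using cat_fps_eq by (simp add: subst.ev_add A)
    have quot: "fps_X * cat_fps ^ 2 * subst.ev (quot_a (fe_sol i)) = g i - fps_const (g i $ 0)" for i
      unfolding g_def by (rule subst_quot_a)
    \<comment> \<open>The factor \<open>fps_X\<close> in \<open>quot\<close> is cancelled by
      comparing coefficients at \<open>Suc l\<close>.\<close>
    have Da: "(cat_fps ^ 2 * subst.ev (quot_a (fe_sol i))) $ l = g i $ Suc l" for i l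
      using arg_cong[OF quot[of i], of "\<lambda>F. F $ Suc l"] by (simp add: mult.assoc)
    have C: "(cat_fps ^ 2) $ l = of_nat (cat (Suc l))" for l
      using arg_cong[OF cat_fps_eq, of "\<lambda>F. F $ Suc l"] by (simp add: cat_fps_def)
    have "subst.ev (fe_sol n) = (if m = 0 then fps_const (u ^ 2) * cat_fps ^ 2 else 0)
      + fps_const u * (cat_fps ^ 2 * subst.ev (quot_a (fe_sol m))
        + (\<Sum>i\<le>m. (g i - fps_const (g i $ 0)) * subst.ev (poly_shift 1 (fe_sol (m - i)))))
      + fps_const u * ((fps_X * cat_fps ^ 2) * g m)"
      unfolding Suc fe_sol.simps(2) subst.ev_add[of "_ + _"] subst.ev_add[of _ "(1 + varX) * _"]
        subst.ev_add[of "(1 + varA)^2 * _"] subst.ev_mult subst.ev_power subst.ev_sum if_distrib[of subst.ev]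
        X A A1 subst.ev_0 quot[symmetric]
      unfolding g_def by (simp add: sum_distrib_left mult.assoc fps_const_power)
    moreover have "(if m = 0 then fps_const (u ^ 2) * cat_fps ^ 2 else 0) $ l
        = (if m = 0 then u ^ 2 * of_nat (cat (Suc l)) else 0)"
      by (simp add: C)
    \<comment> \<open>Here the factor \<open>a\<close> has been absorbed into the divided
      difference; the constant term is gone, so the convolution starts at index 1.\<close>
    moreover have "((g i - fps_const (g i $ 0)) * subst.ev (poly_shift 1 (fe_sol (m - i)))) $ l
        = (\<Sum>p<l. g i $ Suc p * poly_shift 1 (g (m - i) $ (l - Suc p)))" for i
      by (subst fps_mult_nth_Suc) (simp_all only: nth_subst_poly_shift g_def, simp_all)
    moreover have "(fps_X * cat_fps ^ 2 * g m) $ l = (\<Sum>p<l. of_nat (cat (Suc p)) * g m $ (l - Suc p))"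
      by (subst fps_mult_nth_Suc) (simp_all add: C)
    ultimately have "subst.ev (fe_sol n) $ l = (if m = 0 then u ^ 2 * of_nat (cat (Suc l)) else 0)
      + u * (g m $ Suc l + (\<Sum>i\<le>m. \<Sum>p<l. g i $ Suc p * poly_shift 1 (g (m - i) $ (l - Suc p))))
      + u * (\<Sum>p<l. of_nat (cat (Suc p)) * g m $ (l - Suc p))"
      by (simp only: fps_add_nth fps_mult_left_const_nth fps_sum_nth Da)
    also have "\<dots> = sortable_poly n l"
      unfolding Suc sortable_poly_Suc by (simp add: g algebra_simps)
    finally show ?thesis .
  qed (simp add: sortable_poly_def)
qed

text \<open>At \<open>y = 0\<close> the substitution sets \<open>a = 0\<close>, so the
  \<open>y\<close>-constant term at \<open>x = 0\<close> is the value at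
  \<open>a = x = 0\<close>.\<close>

lemma coeff_0_nth_0_subst: "coeff (subst.ev p $ 0) 0 = coeff (coeff p 0) 0"
  by (cases p) (simp add: subst.ev_pCons nth_0_subst_a)

theorem theorem2p1:
  shows "(\<exists>!Q. functional_eq Q) \<and> (\<forall>Q. functional_eq Q \<longrightarrow> W = eval00 Q)"
proof -
  have "W = eval00 (Abs_fps fe_sol)"
  proof (rule fps_ext)
    fix n
    show "W $ n = eval00 (Abs_fps fe_sol) $ n"
      using w_eq_coeff_sortable_poly[of n]
      by (cases "n = 0") (simp_all add: W_def eval00_def subst_fe_sol sortable_poly_def[of 0] flip: coeff_0_nth_0_subst)
  qed
  then show ?thesis
    by (simp add: functional_eq_iff_fe_sol)
qed

end
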